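(* Let $p>3$ be a prime. Then $$\sum_{k=1}^{p-1}\frac{(-1)^k}k\binom{-1/3}k\equiv \frac 32q_p(3)-\frac 34pq_p(3)^2-\frac{3-\big(\frac{-3}p\big)}2pU_{p-3}\pmod{p^2}.$$
   Context: For $x,y\in\mathbb Q$ with denominators prime to $p$, $x\equiv y\pmod{p^m}$ means $(x-y)/p^m$ has denominator prime to $p$. For rational $a$ and integer $k\ge0$, $\binom ak=a(a-1)\cdots(a-k+1)/k!$. $q_p(3)=(3^{p-1}-1)/p$ is the Fermat quotient, $\big(\frac{-3}p\big)$ the Legendre symbol. The sequence $\{U_n\}$ is defined by $U_0=1$ and $U_n=-2\sum_{k=1}^{[n/2]}\binom n{2k}U_{n-2k}$ for $n\ge1$. *)

theory Defs
  imports "HOL-Number_Theory.Number_Theory"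
begin

text \<open>
  \<^const>\<open>quotient_of\<close> returns numerator and positive denominator in lowest terms.
\<close>

definition p_integral :: "nat \<Rightarrow> rat \<Rightarrow> bool" where
  "p_integral p x \<longleftrightarrow> coprime (snd (quotient_of x)) (int p)"

text \<open>
  The congruence is only meaningful between rationals whose denominators are prime to
  \<open>p\<close>, so this requirement on both sides is part of the relation.
\<close>

definition rat_cong :: "nat \<Rightarrow> nat \<Rightarrow> rat \<Rightarrow> rat \<Rightarrow> bool" where
  "rat_cong p m x y \<longleftrightarrow>
     p_integral p x \<and> p_integral p y \<and> p_integral p ((x - y) / of_nat p ^ m)"

definition fermat_quotient :: "nat \<Rightarrow> nat \<Rightarrow> rat" where
  "fermat_quotient p a = (of_nat a ^ (p - 1) - 1) / of_nat p"

function U :: "nat \<Rightarrow> int" where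
  "U n = (if n = 0 then 1
          else - 2 * (\<Sum>k = 1..n div 2. int (n choose (2 * k)) * U (n - 2 * k)))"
  by pat_completeness auto
termination
  by (relation "measure id") auto

declare U.simps [simp del]

end

theory Submission
  imports Defs "HOL-Computational_Algebra.Formal_Power_Series"
begin

text \<open>
  Let \<open>m = p div 3\<close>, \<open>H = (\<Sum>i\<le>m. 1 / i)\<close>, \<open>H2 = (\<Sum>i\<le>m. 1 / i\<^sup>2)\<close>, let \<open>q\<close> be the Fermat quotient of
  3 and \<open>\<chi>\<close> the Legendre symbol of \<open>-3\<close>. With \<open>S a\<close> the sum on the left for a general upper
  argument \<open>a\<close>, one has \<open>S a - S (a - 1) = ((a - 1 gchoose p - 1) - 1) / a\<close>, and summing this from
  \<open>p t\<close> to \<open>p t + r = -1/3\<close>, with \<open>t\<close> one of \<open>-1/3\<close> and \<open>-2/3\<close>, expresses the left hand side through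
  \<open>H\<close> and \<open>p H2\<close> modulo \<open>p\<^sup>2\<close>. Multiplication by 3 on the residues gives
  \<open>H \<equiv> - 3/2 q + 3/4 p q\<^sup>2 - p/3 H2\<close>.

  It remains to see that \<open>H2 \<equiv> 3 \<chi> U (p - 3)\<close> modulo \<open>p\<close>. The exponential generating function of \<open>U\<close>
  is \<open>1 / (exp t + exp (-t) - 1)\<close>, so the polynomials \<open>f x = (\<Sum>k. (n choose k) U k x ^ (n - k))\<close>
  satisfy \<open>f (x + 1) - f x + f (x - 1) = x ^ n\<close>, hence \<open>f (x + 3) + f x = (x + 1) ^ n + (x + 2) ^ n\<close>.
  For \<open>n = p - 3\<close>, going in steps of 3 from \<open>\<chi>\<close>, where \<open>f\<close> is \<open>U n / 2\<close>, to \<open>p\<close>, where it is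
  congruent to \<open>U n\<close>, produces the alternating sum of \<open>1 / i\<^sup>2\<close> over \<open>i \<le> m\<close>, which is
  congruent to \<open>3/2 H2\<close>.
\<close>

section \<open>Congruences between \<open>p\<close>-integral rationals\<close>

text \<open>The reduced denominator divides the denominator of every other representation, so any
  fraction with denominator prime to \<open>p\<close> serves as a witness. Closure under ring
  operations then avoids reduction to lowest terms.\<close>

lemma p_integral_iff:
  assumes "prime p"
  shows "p_integral p x \<longleftrightarrow> (\<exists>a b. \<not> int p dvd b \<and> x = of_int a / of_int b)"
proof
  assume h: "p_integral p x"
  obtain a b where ab: "quotient_of x = (a, b)" by fastforce
  have "coprime b (int p)" using h ab by (simp add: p_integral_def)
  then have "\<not> int p dvd b"
    using assms by (metis coprime_absorb_right not_prime_unit prime_nat_int_transfer)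
  then show "\<exists>a b. \<not> int p dvd b \<and> x = of_int a / of_int b"
    using quotient_of_div[OF ab] by blast
next
  assume "\<exists>a b. \<not> int p dvd b \<and> x = of_int a / of_int b"
  then obtain c d where cd: "\<not> int p dvd d" "x = of_int c / of_int d" by blast
  obtain a b where ab: "quotient_of x = (a, b)" by fastforce
  have x: "x = of_int a / of_int b" and b: "b > 0" and cop: "coprime a b"
    using quotient_of_div[OF ab] quotient_of_denom_pos[OF ab] quotient_of_coprime[OF ab] by auto
  have d: "d \<noteq> 0" using cd(1) by auto
  have "(of_int (a * d) :: rat) = of_int (c * b)"
    using x cd(2) b d by (simp add: field_simps)
  then have "a * d = c * b" by (simp only: of_int_eq_iff)
  then have "b dvd a * d" by simp
  then have "b dvd d" using cop by (simp add: coprime_commute coprime_dvd_mult_right_iff)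
  moreover have "coprime d (int p)"
    using cd(1) assms by (metis coprime_commute prime_imp_coprime prime_nat_int_transfer)
  ultimately have "coprime b (int p)"
    using coprime_divisors[OF _ dvd_refl] by metis
  then show "p_integral p x" using ab by (simp add: p_integral_def)
qed

section \<open>The ring of \<open>p\<close>-integral rationals\<close>

locale prime_modulus =
  fixes p :: nat
  assumes prime_p: "prime p"
begin

lemma prime_int_p: "prime (int p)"
  using prime_p by simp

lemma p_pos: "p > 0"
  using prime_p by (simp add: prime_gt_0_nat)

lemma p_integral_of_int [simp, intro]: "p_integral p (of_int a)"
  by (simp add: p_integral_def)

lemma p_integral_of_nat [simp, intro]: "p_integral p (of_nat a)"
  using p_integral_of_int[of "int a"] by simp

lemma p_integral_numeral [simp, intro]: "p_integral p (numeral a)"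
  using p_integral_of_nat[of "numeral a"] by simp

lemma p_integral_0 [simp, intro]: "p_integral p 0"
  using p_integral_of_nat[of 0] by simp

lemma p_integral_1 [simp, intro]: "p_integral p 1"
  using p_integral_of_nat[of 1] by simp

lemma p_integral_add [intro]:
  assumes "p_integral p x" "p_integral p y"
  shows "p_integral p (x + y)"
proof -
  obtain a b c d where h: "\<not> int p dvd b" "x = of_int a / of_int b"
    "\<not> int p dvd d" "y = of_int c / of_int d"
    using assms prime_p by (auto simp: p_integral_iff)
  then have "b \<noteq> 0" "d \<noteq> 0" by auto
  then have "x + y = of_int (a * d + c * b) / of_int (b * d)"
    using h by (simp add: field_simps)
  moreover have "\<not> int p dvd b * d"
    using h prime_int_p by (simp add: prime_dvd_mult_iff)
  ultimately show ?thesis using prime_p p_integral_iff by blast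
qed

lemma p_integral_mult [intro]:
  assumes "p_integral p x" "p_integral p y"
  shows "p_integral p (x * y)"
proof -
  obtain a b c d where h: "\<not> int p dvd b" "x = of_int a / of_int b"
    "\<not> int p dvd d" "y = of_int c / of_int d"
    using assms prime_p by (auto simp: p_integral_iff)
  then have "x * y = of_int (a * c) / of_int (b * d)"
    by simp
  moreover have "\<not> int p dvd b * d"
    using h prime_int_p by (simp add: prime_dvd_mult_iff)
  ultimately show ?thesis using prime_p p_integral_iff by blast
qed

lemma p_integral_minus [intro]: "p_integral p x \<Longrightarrow> p_integral p (- x)"
  using p_integral_mult[of "of_int (-1)" x] p_integral_of_int[of "-1"] by simp

lemma p_integral_diff [intro]: "p_integral p x \<Longrightarrow> p_integral p y \<Longrightarrow> p_integral p (x - y)"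
  using p_integral_add[of x "- y"] p_integral_minus by simp

lemma p_integral_power [intro]: "p_integral p x \<Longrightarrow> p_integral p (x ^ n)"
  by (induction n) auto

lemma p_integral_sum [intro]: "(\<And>i. i \<in> A \<Longrightarrow> p_integral p (f i)) \<Longrightarrow> p_integral p (sum f A)"
  by (induction A rule: infinite_finite_induct) auto

text \<open>With \<open>t = a / b\<close> the divisor is \<open>(p * a + i * b) / b\<close>, whose
  numerator is prime to \<open>p\<close>. Such divisors arise from the upper arguments
  \<open>p * t + r\<close> of the binomial sum.\<close>

lemma p_integral_divide_shift:
  assumes t: "p_integral p t" and i: "\<not> int p dvd i" and x: "p_integral p x"
  shows "of_nat p * t + of_int i \<noteq> 0" "p_integral p (x / (of_nat p * t + of_int i))"
proof -
  obtain a b where h: "\<not> int p dvd b" "t = of_int a / of_int b"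
    using t prime_p by (auto simp: p_integral_iff)
  then have b: "b \<noteq> 0" by auto
  define c where "c = int p * a + i * b"
  have c: "\<not> int p dvd c"
    using h i prime_int_p by (simp add: c_def dvd_add_right_iff prime_dvd_mult_iff)
  have e: "of_nat p * t + of_int i = of_int c / of_int b"
    using h b by (simp add: c_def field_simps)
  have c0: "c \<noteq> 0" using c by auto
  then show "of_nat p * t + of_int i \<noteq> 0" using e b by simp
  have "p_integral p (1 / (of_nat p * t + of_int i))"
    unfolding e p_integral_iff[OF prime_p] using c by (intro exI[of _ b] exI[of _ c]) simp
  then show "p_integral p (x / (of_nat p * t + of_int i))"
    using p_integral_mult[OF x] by fastforce
qed

lemma p_integral_divide_of_nat:
  assumes "\<not> p dvd i" and "p_integral p x"
  shows "p_integral p (x / of_nat i)"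
  using p_integral_divide_shift(2)[of 0 "int i" x] assms by simp

lemma p_integral_divide_less:
  assumes "0 < i" "i < p" and "p_integral p x"
  shows "p_integral p (x / of_nat i)"
  using p_integral_divide_of_nat[of i x] assms nat_dvd_not_less by blast

section \<open>Calculus of congruences modulo \<open>p ^ m\<close>\<close>

lemma rat_congI:
  assumes "p_integral p y" "p_integral p z" "x = y + of_nat p ^ m * z"
  shows "rat_cong p m x y"
  using assms prime_p prime_gt_0_nat[OF prime_p] by (auto simp: rat_cong_def)

lemma rat_congE:
  assumes "rat_cong p m x y"
  obtains z where "p_integral p z" "x = y + of_nat p ^ m * z"
proof
  show "p_integral p ((x - y) / of_nat p ^ m)" using assms by (simp add: rat_cong_def)
  show "x = y + of_nat p ^ m * ((x - y) / of_nat p ^ m)"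
    using prime_gt_0_nat[OF prime_p] by simp
qed

lemma rat_cong_integral:
  assumes "rat_cong p m x y"
  shows "p_integral p x" "p_integral p y"
  using assms by (auto simp: rat_cong_def)

lemma rat_cong_refl [intro]: "p_integral p x \<Longrightarrow> rat_cong p m x x"
  by (rule rat_congI[of _ 0]) auto

lemma rat_cong_sym:
  assumes "rat_cong p m x y"
  shows "rat_cong p m y x"
proof -
  obtain z where "p_integral p z" "x = y + of_nat p ^ m * z"
    using assms rat_congE by blast
  then show ?thesis
    using rat_cong_integral[OF assms] by (intro rat_congI[of _ "- z"]) auto
qed

lemma rat_cong_add:
  assumes "rat_cong p m x y" "rat_cong p m u v"
  shows "rat_cong p m (x + u) (y + v)"
proof -
  obtain z w where "p_integral p z" "x = y + of_nat p ^ m * z"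
    "p_integral p w" "u = v + of_nat p ^ m * w"
    using assms rat_congE by metis
  then show ?thesis
    using rat_cong_integral[OF assms(1)] rat_cong_integral[OF assms(2)]
    by (intro rat_congI[of _ "z + w"]) (auto simp: algebra_simps)
qed

lemma rat_cong_mult:
  assumes "rat_cong p m x y" "rat_cong p m u v"
  shows "rat_cong p m (x * u) (y * v)"
proof -
  obtain z w where h: "p_integral p z" "x = y + of_nat p ^ m * z"
    "p_integral p w" "u = v + of_nat p ^ m * w"
    using assms rat_congE by metis
  note i = rat_cong_integral[OF assms(1)] rat_cong_integral[OF assms(2)]
  show ?thesis
  proof (rule rat_congI[of _ "z * u + y * w"])
    show "x * u = y * v + of_nat p ^ m * (z * u + y * w)"
      using h by (simp add: algebra_simps)
  qed (use h i in auto)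
qed

lemma rat_cong_trans [trans]:
  assumes "rat_cong p m x y" "rat_cong p m y v"
  shows "rat_cong p m x v"
  using rat_cong_add[OF assms] rat_cong_integral[OF assms(1)] rat_cong_integral[OF assms(2)]
  by (auto simp: rat_cong_def)

lemma rat_cong_scale: "p_integral p c \<Longrightarrow> rat_cong p m x y \<Longrightarrow> rat_cong p m (c * x) (c * y)"
  by (intro rat_cong_mult) auto

lemma rat_cong_minus: "rat_cong p m x y \<Longrightarrow> rat_cong p m (- x) (- y)"
  using rat_cong_scale[of "of_int (-1)"] p_integral_of_int[of "-1"] by simp

lemma rat_cong_diff:
  "rat_cong p m x y \<Longrightarrow> rat_cong p m u v \<Longrightarrow> rat_cong p m (x - u) (y - v)"
  using rat_cong_add[of m x y "- u" "- v"] rat_cong_minus by simp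

lemma rat_cong_sum:
  "(\<And>i. i \<in> A \<Longrightarrow> rat_cong p m (f i) (g i)) \<Longrightarrow> rat_cong p m (sum f A) (sum g A)"
  by (induction A rule: infinite_finite_induct) (auto intro: rat_cong_add)

lemma rat_cong_power: "rat_cong p m x y \<Longrightarrow> rat_cong p m (x ^ n) (y ^ n)"
  by (induction n) (auto intro: rat_cong_mult)

text \<open>The factor \<open>p\<close> gains one power of precision, so sums known only modulo
  \<open>p\<close> can be used modulo \<open>p ^ 2\<close> in terms that carry
  \<open>p\<close>.\<close>

lemma rat_cong_p_mult:
  assumes "rat_cong p m x y"
  shows "rat_cong p (Suc m) (of_nat p * x) (of_nat p * y)"
proof -
  obtain z where "p_integral p z" "x = y + of_nat p ^ m * z"
    using assms rat_congE by blast
  then show ?thesis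
    using rat_cong_integral[OF assms] by (intro rat_congI[of _ z]) (auto simp: algebra_simps)
qed

lemma rat_cong_of_int:
  assumes "[a = b] (mod int p)"
  shows "rat_cong p 1 (of_int a) (of_int b)"
proof -
  obtain c where "a = b + int p * c"
    using assms by (metis cong_iff_lin cong_sym)
  then show ?thesis by (intro rat_congI[of _ "of_int c"]) auto
qed

lemma rat_cong_p_0: "rat_cong p 1 (of_nat p) 0"
  by (rule rat_congI[of _ 1]) auto

lemma rat_cong_cancel:
  assumes "rat_cong p m (of_nat c * x) (of_nat c * y)" "\<not> p dvd c"
  shows "rat_cong p m x y"
proof -
  have "p_integral p (1 / of_nat c)" by (rule p_integral_divide_of_nat[OF assms(2)]) simp
  from rat_cong_scale[OF this assms(1)] show ?thesis
    using assms(2) by (cases "c = 0") auto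
qed

end

section \<open>Harmonic sums modulo a prime\<close>

definition hsum :: "nat \<Rightarrow> nat \<Rightarrow> rat" where
  "hsum e n = (\<Sum>i = 1..n. 1 / of_nat i ^ e)"

lemma hsum_0 [simp]: "hsum e 0 = 0"
  by (simp add: hsum_def)

lemma hsum_Suc: "hsum e (Suc n) = hsum e n + 1 / of_nat (Suc n) ^ e"
  by (simp add: hsum_def)

context prime_modulus
begin

text \<open>An injective self-map of a finite set is onto. Applied with \<open>c = 2\<close> to
  inverse squares and with \<open>c = 3\<close> to the Fermat quotient.\<close>

lemma bij_betw_mult_mod:
  assumes "\<not> p dvd c"
  shows "bij_betw (\<lambda>i. (c * i) mod p) {1..p - 1} {1..p - 1}"
proof -
  have inj: "inj_on (\<lambda>i. (c * i) mod p) {1..p - 1}"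
  proof (rule inj_onI)
    fix i j assume h: "i \<in> {1..p - 1}" "j \<in> {1..p - 1}" "(c * i) mod p = (c * j) mod p"
    have "coprime c p"
      using assms prime_p by (metis coprime_commute prime_imp_coprime)
    then have "[i = j] (mod p)"
      using h(3) by (simp add: cong_def cong_mult_lcancel_nat[unfolded cong_def])
    then show "i = j" using h p_pos by (auto simp: cong_def)
  qed
  have "(\<lambda>i. (c * i) mod p) ` {1..p - 1} \<subseteq> {1..p - 1}"
  proof
    fix j assume "j \<in> (\<lambda>i. (c * i) mod p) ` {1..p - 1}"
    then obtain i where i: "i \<in> {1..p - 1}" "j = (c * i) mod p" by blast
    have "\<not> p dvd i" using i(1) by (auto simp: dvd_imp_le dest!: dvd_imp_le)
    then have "\<not> p dvd c * i" using assms prime_p by (simp add: prime_dvd_mult_iff)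
    then have "j > 0" using i(2) by (auto simp: dvd_eq_mod_eq_0)
    moreover have "j < p" using i(2) p_pos by simp
    ultimately show "j \<in> {1..p - 1}" by auto
  qed
  then show ?thesis
    using inj by (simp add: bij_betw_def endo_inj_surj)
qed

lemma inverse_power_cong:
  assumes x: "rat_cong p 1 (of_int a) (of_int b)" and "\<not> int p dvd a"
  shows "rat_cong p 1 (1 / of_int a ^ e) (1 / of_int b ^ e)"
proof -
  obtain z where z: "p_integral p z" "of_int a = of_int b + of_nat p ^ 1 * z"
    using x rat_congE by blast
  \<comment> \<open>In this form \<open>p_integral_divide_shift\<close> shows that \<open>b\<close>
    is a unit too, from the assumption on \<open>a\<close> alone.\<close>
  have b: "of_int b = of_nat p * (- z) + of_int a" using z by simp
  have b0: "of_int b \<noteq> (0::rat)" "p_integral p (1 / of_int b)"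
    using p_integral_divide_shift[of "- z" a 1] assms z(1) unfolding b by auto
  have a0: "of_int a \<noteq> (0::rat)" "p_integral p (1 / of_int a)"
    using p_integral_divide_shift[of 0 a 1] assms by auto
  have "rat_cong p 1 (1 / of_int a) (1 / of_int b)"
  proof (rule rat_congI[of _ "- (z * (1 / of_int a) * (1 / of_int b))"])
    have "(1::rat) / of_int a - 1 / of_int b = (of_int b - of_int a) * (1 / of_int a) * (1 / of_int b)"
      using a0(1) b0(1) by (simp add: field_simps)
    also have "of_int b - of_int a = - (of_nat p * z)" using z(2) by simp
    finally show "(1::rat) / of_int a = 1 / of_int b + of_nat p ^ 1 * - (z * (1 / of_int a) * (1 / of_int b))"
      by (simp add: mult.assoc)
  qed (intro b0(2) p_integral_minus p_integral_mult z(1) a0(2))+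
  from rat_cong_power[OF this, of e] show ?thesis by (simp add: power_one_over)
qed

lemma inverse_power_cong_nat:
  assumes "[int a = int b] (mod int p)" "\<not> p dvd a"
  shows "rat_cong p 1 (1 / of_nat a ^ e) (1 / of_nat b ^ e)"
  using inverse_power_cong[of "int a" "int b" e] rat_cong_of_int[OF assms(1)] assms(2) by simp

text \<open>\<open>p - i\<close> is congruent to \<open>- i\<close>, and squaring removes the
  sign.\<close>

lemma inverse_square_reflect:
  assumes "0 < i" "i < p"
  shows "rat_cong p 1 (1 / of_nat (p - i) ^ 2) (1 / of_nat i ^ 2)"
proof -
  have "\<not> p dvd p - i" using assms by (auto dest: dvd_imp_le)
  moreover have "rat_cong p 1 (of_int (int (p - i))) (of_int (- int i))"
    using assms by (intro rat_cong_of_int) (simp add: of_nat_diff cong_iff_dvd_diff)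
  ultimately have "rat_cong p 1 (1 / of_int (int (p - i)) ^ 2) (1 / of_int (- int i) ^ 2)"
    by (intro inverse_power_cong) auto
  then show ?thesis by simp
qed

lemma p_integral_inverse_power:
  assumes "0 < i" "i < p"
  shows "p_integral p (1 / of_nat i ^ e)"
  using p_integral_power[OF p_integral_divide_less[OF assms p_integral_1], of e]
  by (simp add: power_one_over)

lemma p_integral_hsum [intro]: "n < p \<Longrightarrow> p_integral p (hsum e n)"
  unfolding hsum_def by (auto intro!: p_integral_sum p_integral_inverse_power)

end

section \<open>Harmonic sums up to \<open>p - 1\<close> and their reflections\<close>

locale prime_gt3 = prime_modulus +
  assumes gt3: "p > 3"
begin

lemma not_dvd_less: "0 < c \<Longrightarrow> c < p \<Longrightarrow> \<not> p dvd c"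
  by (auto dest: dvd_imp_le)

lemma odd_p: "odd p"
  using prime_p gt3 prime_odd_nat by auto

lemma sum_reflect: "(\<Sum>i = 1..p - 1. f (p - i)) = (\<Sum>i = 1..p - 1. f i)"
  by (rule sum.reindex_bij_witness[of _ "\<lambda>i. p - i" "\<lambda>i. p - i"]) auto

text \<open>Doubling permutes the nonzero residues and multiplies the sum by \<open>1 / 4\<close>.
  Hence three times the sum vanishes, and 3 is a unit because \<open>p > 3\<close>.\<close>

lemma hsum_2_p: "rat_cong p 1 (hsum 2 (p - 1)) 0"
proof -
  have "(\<Sum>i = 1..p - 1. 1 / of_nat ((2 * i) mod p) ^ 2) = hsum 2 (p - 1)"
    unfolding hsum_def
    by (rule sum.reindex_bij_betw[OF bij_betw_mult_mod]) (use not_dvd_less[of 2] gt3 in auto)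
  moreover have "rat_cong p 1 (\<Sum>i = 1..p - 1. 1 / of_nat ((2 * i) mod p) ^ 2)
      (\<Sum>i = 1..p - 1. 1 / of_nat (2 * i) ^ 2)"
  proof (intro rat_cong_sum rat_cong_sym[OF inverse_power_cong_nat])
    fix i assume "i \<in> {1..p - 1}"
    then have "\<not> p dvd i" by (intro not_dvd_less) auto
    then show "\<not> p dvd 2 * i" using not_dvd_less[of 2] gt3 prime_p
      by (simp add: prime_dvd_mult_iff)
    show "[int (2 * i) = int (2 * i mod p)] (mod int p)"
      by (simp add: cong_def zmod_int)
  qed
  moreover have "(\<Sum>i = 1..p - 1. 1 / of_nat (2 * i) ^ 2) = 1 / 4 * hsum 2 (p - 1)"
    by (simp add: hsum_def sum_divide_distrib power_mult_distrib mult.commute)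
  ultimately have "rat_cong p 1 (hsum 2 (p - 1)) (1 / 4 * hsum 2 (p - 1))" by (simp only:)
  from rat_cong_scale[OF p_integral_numeral[of "num.Bit0 (num.Bit0 num.One)"] this]
  have "rat_cong p 1 (4 * hsum 2 (p - 1)) (hsum 2 (p - 1))" by simp
  from rat_cong_diff[OF this rat_cong_refl[OF p_integral_hsum[of "p - 1" 2]]]
  have "rat_cong p 1 (of_nat 3 * hsum 2 (p - 1)) (of_nat 3 * 0)" using p_pos by simp
  then show ?thesis using rat_cong_cancel[of 1 3 _ 0] not_dvd_less[of 3] gt3 by simp
qed

text \<open>First-order expansion of \<open>1 / (p - i)\<close> in powers of \<open>p\<close>; the
  exact remainder is \<open>p ^ 2 / (i ^ 2 * (p - i))\<close>.\<close>

lemma inverse_diff_expand: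
  assumes "0 < i" "i < p"
  shows "rat_cong p 2 (1 / of_nat (p - i)) (- 1 / of_nat i - of_nat p * (1 / of_nat i ^ 2))"
proof (rule rat_congI[of _ "1 / of_nat i ^ 2 * (1 / of_nat (p - i))"])
  show "1 / of_nat (p - i) = - 1 / of_nat i - of_nat p * (1 / of_nat i ^ 2) +
      (of_nat p ^ 2 * (1 / of_nat i ^ 2 * (1 / of_nat (p - i))) :: rat)"
    using assms by (simp add: field_simps of_nat_diff power2_eq_square)
  show "p_integral p (1 / of_nat i ^ 2 * (1 / of_nat (p - i)))"
    using assms by (intro p_integral_mult p_integral_inverse_power p_integral_divide_less) auto
  show "p_integral p (- 1 / of_nat i - of_nat p * (1 / of_nat i ^ 2))"
    using p_integral_inverse_power[of i 2] p_integral_minus[OF p_integral_inverse_power[of i 1]] assms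
    by (intro p_integral_diff p_integral_mult) auto
qed

text \<open>Wolstenholme's theorem. The reflection of \<open>i\<close> to \<open>p - i\<close> gives
  \<open>H = - H - p * H2\<close> modulo \<open>p ^ 2\<close>, where the last term vanishes by
  \<open>hsum_2_p\<close>, and 2 can be cancelled.\<close>

lemma hsum_1_p: "rat_cong p 2 (hsum 1 (p - 1)) 0"
proof -
  have "hsum 1 (p - 1) = (\<Sum>i = 1..p - 1. 1 / of_nat (p - i))"
    unfolding hsum_def using sum_reflect[of "\<lambda>i. 1 / rat_of_nat i", symmetric] by simp
  also have "rat_cong p 2 \<dots> (\<Sum>i = 1..p - 1. - 1 / of_nat i - of_nat p * (1 / of_nat i ^ 2))"
    by (rule rat_cong_sum[OF inverse_diff_expand]) auto
  also have "\<dots> = - hsum 1 (p - 1) - of_nat p * hsum 2 (p - 1)"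
    by (simp add: hsum_def sum_subtractf sum_distrib_left sum_negf)
  finally have 1: "rat_cong p 2 (hsum 1 (p - 1)) (- hsum 1 (p - 1) - of_nat p * hsum 2 (p - 1))" .
  have "rat_cong p 2 (of_nat p * hsum 2 (p - 1)) 0"
    using rat_cong_p_mult[OF hsum_2_p] by (simp add: numeral_2_eq_2)
  from rat_cong_add[OF rat_cong_add[OF 1 this] rat_cong_refl[OF p_integral_hsum[of "p - 1" 1]]]
  have "rat_cong p 2 (2 * hsum 1 (p - 1) + of_nat p * hsum 2 (p - 1)) (- (of_nat p * hsum 2 (p - 1)))"
    using p_pos by simp
  from rat_cong_diff[OF this \<open>rat_cong p 2 (of_nat p * hsum 2 (p - 1)) 0\<close>]
  have "rat_cong p 2 (2 * hsum 1 (p - 1)) (- (of_nat p * hsum 2 (p - 1)))" by simp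
  also have "rat_cong p 2 \<dots> (- 0)"
    by (rule rat_cong_minus) fact
  finally have "rat_cong p 2 (of_nat 2 * hsum 1 (p - 1)) (of_nat 2 * 0)" by simp
  then show ?thesis using rat_cong_cancel[of 2 2 _ 0] not_dvd_less[of 2] gt3 by simp
qed

lemma sum_split_reflect:
  fixes f :: "nat \<Rightarrow> rat"
  assumes "m < p"
  shows "(\<Sum>i = 1..p - 1 - m. f i) = (\<Sum>i = 1..p - 1. f i) - (\<Sum>i = 1..m. f (p - i))"
proof -
  have "(\<Sum>i = 1..m. f (p - i)) = (\<Sum>i = p - m..p - 1. f i)"
    using assms by (intro sum.reindex_bij_witness[of _ "\<lambda>i. p - i" "\<lambda>i. p - i"]) auto
  moreover have "{1..p - 1} = {1..p - 1 - m} \<union> {p - m..p - 1}"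
    using assms by auto
  then have "(\<Sum>i = 1..p - 1. f i) = (\<Sum>i = 1..p - 1 - m. f i) + (\<Sum>i = p - m..p - 1. f i)"
    using assms by (simp only:) (rule sum.union_disjoint, auto)
  ultimately show ?thesis by simp
qed

text \<open>The full sum up to \<open>p - 1\<close> vanishes modulo \<open>p ^ 2\<close>, so only
  the removed top \<open>m\<close> terms \<open>1 / (p - i)\<close> count, and these are expanded to
  first order.\<close>

lemma hsum_1_reflect:
  assumes "m < p"
  shows "rat_cong p 2 (hsum 1 (p - 1 - m)) (hsum 1 m + of_nat p * hsum 2 m)"
proof -
  have "hsum 1 (p - 1 - m) = hsum 1 (p - 1) - (\<Sum>i = 1..m. 1 / of_nat (p - i))"
    unfolding hsum_def using sum_split_reflect[OF assms, of "\<lambda>i. 1 / of_nat i ^ 1"] by simp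
  also have "rat_cong p 2 \<dots> (0 - (\<Sum>i = 1..m. - 1 / of_nat i - of_nat p * (1 / of_nat i ^ 2)))"
    by (intro rat_cong_diff hsum_1_p rat_cong_sum[OF inverse_diff_expand]) (use assms in auto)
  also have "\<dots> = hsum 1 m + of_nat p * hsum 2 m"
    by (simp add: hsum_def sum_subtractf sum_distrib_left sum_negf)
  finally show ?thesis .
qed

lemma hsum_2_reflect:
  assumes "m < p"
  shows "rat_cong p 1 (hsum 2 (p - 1 - m)) (- hsum 2 m)"
proof -
  have "hsum 2 (p - 1 - m) = hsum 2 (p - 1) - (\<Sum>i = 1..m. 1 / of_nat (p - i) ^ 2)"
    unfolding hsum_def using sum_split_reflect[OF assms, of "\<lambda>i. 1 / of_nat i ^ 2"] by simp
  also have "rat_cong p 1 \<dots> (0 - (\<Sum>i = 1..m. 1 / of_nat i ^ 2))"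
    by (intro rat_cong_diff hsum_2_p rat_cong_sum inverse_square_reflect) (use assms in auto)
  finally show ?thesis by (simp add: hsum_def)
qed

end

section \<open>The alternating binomial sum\<close>

definition altsum :: "nat \<Rightarrow> rat \<Rightarrow> rat" where
  "altsum n a = (\<Sum>k = 1..n. (- 1) ^ k / of_nat k * (a gchoose k))"

text \<open>Pascal's rule and absorption turn each difference of terms into
  \<open>(a gchoose k) * (- 1) ^ k / a\<close>. The alternating partial sum of binomials has a
  closed form, with sign 1 for even \<open>n\<close>; the \<open>- 1\<close> is the missing term
  \<open>k = 0\<close>.\<close>

lemma altsum_diff:
  fixes a :: rat
  assumes "a \<noteq> 0" "even n"
  shows "altsum n a - altsum n (a - 1) = ((a - 1 gchoose n) - 1) / a"
proof -
  have "altsum n a - altsum n (a - 1) = (\<Sum>k = 1..n. (a gchoose k) * (- 1) ^ k / a)"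
    unfolding altsum_def sum_subtractf[symmetric]
  proof (rule sum.cong)
    fix k assume "k \<in> {1..n}"
    then obtain j where k: "k = Suc j" by (cases k) auto
    have "(a gchoose k) = (a - 1 gchoose j) + (a - 1 gchoose k)"
      using gbinomial_Suc_Suc[of "a - 1" j] k by simp
    moreover have "(a gchoose k) = a / of_nat k * (a - 1 gchoose j)"
      using gbinomial_absorption'[of k a] k by simp
    ultimately have "(a gchoose k) - (a - 1 gchoose k) = of_nat k * (a gchoose k) / a"
      using assms(1) k by simp
    then show "(- 1) ^ k / of_nat k * (a gchoose k) - (- 1) ^ k / of_nat k * (a - 1 gchoose k) =
        (a gchoose k) * (- 1) ^ k / a"
      unfolding right_diff_distrib[symmetric] using k by simp
  qed auto
  also have "\<dots> = (\<Sum>k = 1..n. (a gchoose k) * (- 1) ^ k) / a"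
    by (simp add: sum_divide_distrib)
  also have "(\<Sum>k = 1..n. (a gchoose k) * (- 1) ^ k) = (\<Sum>k\<le>n. (a gchoose k) * (- 1) ^ k) - 1"
    by (simp add: sum.atMost_shift sum.atLeast1_atMost_eq atMost_atLeast0 sum.atLeast_Suc_atMost)
  also have "(\<Sum>k\<le>n. (a gchoose k) * (- 1) ^ k) = (a - 1 gchoose n)"
    using gbinomial_sum_lower_neg[of a n] assms(2) by simp
  finally show ?thesis .
qed

section \<open>Binomial coefficients and the sum at upper arguments \<open>p * t + r\<close>\<close>

context prime_gt3
begin

text \<open>One factor of the numerator is \<open>p * t\<close>, so the others matter only modulo
  \<open>p\<close>, where they are \<open>- 1, ..., - k\<close>. Their product
  \<open>(- 1) ^ k * k!\<close> meets the unit \<open>(k + 1)!\<close> below.\<close>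

lemma gbinomial_p_mult:
  assumes t: "p_integral p t"
  shows "k < p - 1 \<Longrightarrow>
    rat_cong p 2 ((of_nat p * t) gchoose (Suc k)) ((- 1) ^ k * (of_nat p * t) / of_nat (Suc k))"
proof (induction k)
  case 0
  show ?case using t by (auto intro!: rat_cong_refl)
next
  case (Suc k)
  define P :: rat where "P = of_nat p"
  define u where "u = 1 / rat_of_nat (Suc k)"
  define v where "v = 1 / rat_of_nat (Suc (Suc k))"
  have uv: "p_integral p u" "p_integral p v" unfolding u_def v_def using Suc.prems
    by (auto intro!: p_integral_divide_less simp del: of_nat_Suc)
  have uS: "u * of_nat (Suc k) = 1" by (simp add: u_def)
  have t': "p_integral p (P * t - of_nat (Suc k))" "p_integral p ((- 1) ^ k)"
    using t p_integral_of_int[of "(-1)^k"] by (auto simp: P_def simp del: of_nat_Suc)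
  have "rat_cong p 2 (P * t gchoose (Suc k)) ((- 1) ^ k * (P * t) / of_nat (Suc k))"
    using Suc by (simp add: P_def)
  then obtain z where z: "p_integral p z"
    "P * t gchoose (Suc k) = (- 1) ^ k * (P * t) / of_nat (Suc k) + P ^ 2 * z"
    unfolding P_def using rat_congE by blast
  have "rat_cong p 2 ((P * t) gchoose (Suc (Suc k))) ((- 1) ^ Suc k * (P * t) / of_nat (Suc (Suc k)))"
  \<comment> \<open>The witness collects what carries \<open>P ^ 2\<close> after the induction
    hypothesis is multiplied by the next factor \<open>(P * t - of_nat (Suc k)) * v\<close>.\<close>
  proof (rule rat_congI[of _ "(- 1) ^ k * t\<^sup>2 * u * v + z * (P * t - of_nat (Suc k)) * v", folded P_def])
    have "(P * t) gchoose (Suc (Suc k)) = (P * t gchoose Suc k) * (P * t - of_nat (Suc k)) * v"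
      using gbinomial_mult_1[of "P * t" "Suc k"] by (simp add: v_def field_simps)
    also have "\<dots> = ((- 1) ^ k * (P * t) * u + P ^ 2 * z) * (P * t - of_nat (Suc k)) * v"
      by (simp add: z(2) u_def)
    also have "\<dots> = - ((- 1) ^ k * (P * t) * v * (u * of_nat (Suc k))) +
        P ^ 2 * ((- 1) ^ k * t\<^sup>2 * u * v + z * (P * t - of_nat (Suc k)) * v)"
      by (simp only: algebra_simps power2_eq_square)
    finally show "(P * t) gchoose (Suc (Suc k)) = (- 1) ^ Suc k * (P * t) / of_nat (Suc (Suc k)) +
        P ^ 2 * ((- 1) ^ k * t\<^sup>2 * u * v + z * (P * t - of_nat (Suc k)) * v)"
      by (simp add: uS v_def del: of_nat_Suc)
    have "(- 1) ^ Suc k * (P * t) / of_nat (Suc (Suc k)) = - ((- 1) ^ k * (P * t) * v)"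
      by (simp add: v_def)
    then show "p_integral p ((- 1) ^ Suc k * (P * t) / of_nat (Suc (Suc k)))"
      unfolding P_def
      by (simp only:) (intro p_integral_minus p_integral_mult t t' uv p_integral_of_nat)
    show "p_integral p ((- 1) ^ k * t\<^sup>2 * u * v + z * (P * t - of_nat (Suc k)) * v)"
      by (intro p_integral_add p_integral_mult p_integral_power t t' uv z)
  qed
  then show ?case by (simp add: P_def)
qed

text \<open>Absorption with \<open>a = p * t + i + 1\<close> multiplies the coefficient by
  \<open>a / (a - (p - 1))\<close> in each step. This ratio is \<open>(i + 1) / (i + 2)\<close>
  modulo \<open>p\<close>, which is precise enough because the coefficient itself is divisible by
  \<open>p\<close>.\<close>

lemma gbinomial_p_mult_shift:
  assumes t: "p_integral p t"
  shows "Suc i < p \<Longrightarrow>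
    rat_cong p 2 ((of_nat p * t + of_nat i) gchoose (p - 1)) ((of_nat p * t) / of_nat (Suc i))"
proof (induction i)
  case 0
  have odd: "even (p - 1)" using odd_p by simp
  have p2: "Suc (p - 2) = p - 1" using gt3 by simp
  have i: "p_integral p (1 / of_nat (p - 1))"
    using gt3 by (intro p_integral_divide_less) auto
  have "rat_cong p 2 ((of_nat p * t) gchoose (p - 1)) ((- 1) ^ (p - 2) * (of_nat p * t) / of_nat (p - 1))"
    using gbinomial_p_mult[OF t, of "p - 2"] gt3 p2 by simp
  also have "(- 1 :: rat) ^ (p - 2) = - 1" using odd_p gt3 by simp
  \<comment> \<open>Here \<open>- 1 / (p - 1) = 1 - p / (p - 1)\<close>, and the correction meets
    the factor \<open>p * t\<close>.\<close>
  also have "rat_cong p 2 (- 1 * (of_nat p * t) / of_nat (p - 1)) (of_nat p * t)"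
  proof (rule rat_congI[of _ "- t * (1 / of_nat (p - 1))"])
    show "- 1 * (of_nat p * t) / of_nat (p - 1) = of_nat p * t + of_nat p ^ 2 * (- t * (1 / of_nat (p - 1)))"
      using gt3 by (simp add: of_nat_diff field_simps power2_eq_square)
    show "p_integral p (- t * (1 / of_nat (p - 1)))"
      by (intro p_integral_minus p_integral_mult t i)
  qed (use t in auto)
  finally show ?case by simp
next
  case (Suc i)
  define P :: rat where "P = of_nat p"
  define u where "u = 1 / rat_of_nat (Suc i)"
  define v where "v = 1 / rat_of_nat (Suc (Suc i))"
  \<comment> \<open>This is \<open>a - (p - 1)\<close> for the new upper argument \<open>a\<close>,
    rewritten to show that it is a unit, since \<open>i + 2 < p\<close>.\<close>
  define d where "d = P * (t - 1) + rat_of_int (int (Suc (Suc i)))"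
  have d: "d \<noteq> 0" "p_integral p (1 / d)"
    unfolding d_def P_def using Suc.prems t not_dvd_less[of "Suc (Suc i)"]
    by (intro p_integral_divide_shift; auto simp del: of_nat_Suc)+
  have uv: "p_integral p u" "p_integral p v" unfolding u_def v_def using Suc.prems
    by (auto intro!: p_integral_divide_less simp del: of_nat_Suc)
  have uS: "u * of_nat (Suc i) = 1" "v * of_nat (Suc (Suc i)) = 1"
    by (simp_all add: u_def v_def del: of_nat_Suc)
  have "rat_cong p 2 (P * t + of_nat i gchoose (p - 1)) ((P * t) / of_nat (Suc i))"
    using Suc by (simp add: P_def)
  then obtain z where z: "p_integral p z"
    "P * t + of_nat i gchoose (p - 1) = P * t * u + P ^ 2 * z"
    unfolding P_def u_def using rat_congE by (metis times_divide_eq_right mult.right_neutral)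
  have "rat_cong p 2 ((P * t + of_nat (Suc i)) gchoose (p - 1)) ((P * t) / of_nat (Suc (Suc i)))"
  proof (rule rat_congI[of _ "(t * (t + of_nat (Suc i)) * u * v + (P * t + of_nat (Suc i)) * z) * (1 / d)", folded P_def])
    define w where "w = rat_of_nat (Suc i)"
    have "((P * t + w) - of_nat (p - 1)) * ((P * t + w) gchoose (p - 1)) = (P * t + w) * ((P * t + w) - 1 gchoose (p - 1))"
      by (rule gbinomial_absorb_comp)
    moreover have "(P * t + w) - of_nat (p - 1) = d"
      using gt3 by (simp add: d_def w_def P_def of_nat_diff algebra_simps)
    moreover have "(P * t + w) - 1 = P * t + of_nat i" by (simp add: w_def)
    ultimately have 1: "d * ((P * t + w) gchoose (p - 1)) = (P * t + w) * (P * t * u + P ^ 2 * z)"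
      using z(2) by simp
    \<comment> \<open>With \<open>u = 1 / w\<close> and \<open>v = 1 / (w + 1)\<close>, this
      isolates a multiple of \<open>d\<close> whose quotient by \<open>d\<close> is the desired main
      term.\<close>
    have 2: "(P * t + w) * (P * t * u) = d * (P * t * v) + P ^ 2 * (t * (t + w) * u * v)"
    proof -
      have *: "v * (w + 1) = 1" "u * w = 1" using uS by (simp_all add: w_def algebra_simps)
      have "d * (P * t * v) + P ^ 2 * (t * (t + w) * u * v) =
        P * t * v * (d * (u * w)) + P ^ 2 * (t * (t + w) * u * v)" by (simp add: *)
      also have "\<dots> = P * t * u * (v * (d * w + P * (t + w)))"
        by (simp add: algebra_simps power2_eq_square)
      also have "d * w + P * (t + w) = (w + 1) * (P * t + w)"
        by (simp add: d_def w_def algebra_simps)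
      also have "P * t * u * (v * ((w + 1) * (P * t + w))) = (v * (w + 1)) * ((P * t + w) * (P * t * u))"
        by (simp only: mult_ac)
      finally show ?thesis by (simp only: * mult_1_left)
    qed
    have "d * ((P * t + w) gchoose (p - 1)) =
        d * (P * t * v + P ^ 2 * ((t * (t + w) * u * v + (P * t + w) * z) * (1 / d)))"
      unfolding 1 using d 2 by (simp add: algebra_simps)
    then show "(P * t + w) gchoose (p - 1) = (P * t) / of_nat (Suc (Suc i)) +
        P ^ 2 * ((t * (t + w) * u * v + (P * t + w) * z) * (1 / d))"
      using d by (simp add: v_def del: of_nat_Suc)
    show "p_integral p ((t * (t + w) * u * v + (P * t + w) * z) * (1 / d))"
      unfolding P_def w_def by (intro p_integral_add p_integral_mult t uv z d p_integral_of_nat)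
    have "p_integral p (P * t * v)"
      unfolding P_def by (intro p_integral_mult t uv p_integral_of_nat)
    then show "p_integral p (P * t / of_nat (Suc (Suc i)))" by (simp add: v_def)
  qed
  then show ?case by (simp add: P_def)
qed

text \<open>The two signs combine to make the \<open>k\<close>-th term
  \<open>- p * t / k ^ 2\<close>, and the sum of the inverse squares vanishes modulo
  \<open>p\<close>.\<close>

lemma altsum_p_mult:
  assumes t: "p_integral p t"
  shows "rat_cong p 2 (altsum (p - 1) (of_nat p * t)) 0"
proof -
  have "rat_cong p 2 (altsum (p - 1) (of_nat p * t)) (\<Sum>k = 1..p - 1. - (of_nat p * t * (1 / of_nat k ^ 2)))"
    unfolding altsum_def
  proof (rule rat_cong_sum)
    fix k assume k: "k \<in> {1..p - 1}"
    then obtain j where j: "k = Suc j" by (cases k) auto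
    have i: "p_integral p ((- 1) ^ k / of_nat k)"
      using k by (intro p_integral_divide_less p_integral_power p_integral_minus) auto
    from j k have "rat_cong p 2 ((of_nat p * t) gchoose k) ((- 1) ^ j * (of_nat p * t) / of_nat k)"
      using gbinomial_p_mult[OF t, of j] by simp
    from rat_cong_scale[OF i this]
    show "rat_cong p 2 ((- 1) ^ k / of_nat k * (of_nat p * t gchoose k)) (- (of_nat p * t * (1 / of_nat k ^ 2)))"
      by (simp add: j power2_eq_square mult_ac power_mult_distrib flip: power_add mult_2)
  qed
  also have "(\<Sum>k = 1..p - 1. - (of_nat p * t * (1 / of_nat k ^ 2))) = - t * (of_nat p * hsum 2 (p - 1))"
    by (simp add: hsum_def sum_negf sum_distrib_left mult_ac)
  also have "rat_cong p 2 \<dots> (- t * 0)"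
    using rat_cong_scale[OF p_integral_minus[OF t] rat_cong_p_mult[OF hsum_2_p]]
    by (simp add: numeral_2_eq_2)
  finally show ?thesis by simp
qed

text \<open>By \<open>altsum_diff\<close> and \<open>gbinomial_p_mult_shift\<close>, raising the
  upper argument to \<open>p * t + w\<close> adds \<open>(p * t / w - 1) / (p * t + w)\<close>. To
  first order in \<open>p\<close> this is \<open>- 1 / w + 2 * p * t / w ^ 2\<close>.\<close>

lemma altsum_p_mult_shift:
  assumes t: "p_integral p t"
  shows "r < p \<Longrightarrow> rat_cong p 2 (altsum (p - 1) (of_nat p * t + of_nat r))
    (- hsum 1 r + 2 * of_nat p * t * hsum 2 r)"
proof (induction r)
  case 0
  then show ?case using altsum_p_mult[OF t] by simp
next
  case (Suc r)
  define P :: rat where "P = of_nat p"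
  define w where "w = rat_of_nat (Suc r)"
  define d where "d = P * t + rat_of_int (int (Suc r))"
  have dw: "d = P * t + w" by (simp add: d_def w_def)
  have d: "d \<noteq> 0" "p_integral p (1 / d)"
    unfolding d_def P_def using Suc.prems t not_dvd_less[of "Suc r"]
    by (intro p_integral_divide_shift; auto simp del: of_nat_Suc)+
  have w: "w \<noteq> 0" "p_integral p (1 / w)" "p_integral p (1 / w ^ 2)"
    unfolding w_def using Suc.prems
    by (auto intro!: p_integral_divide_less p_integral_inverse_power simp del: of_nat_Suc)
  have "altsum (p - 1) d = altsum (p - 1) (d - 1) + ((d - 1 gchoose (p - 1)) - 1) / d"
    using altsum_diff[OF d(1), of "p - 1"] odd_p by simp
  moreover have "d - 1 = P * t + of_nat r" by (simp add: d_def)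
  ultimately have 1: "altsum (p - 1) d =
      altsum (p - 1) (P * t + of_nat r) + ((P * t + of_nat r gchoose (p - 1)) - 1) / d" by simp
  have "rat_cong p 2 ((P * t + of_nat r gchoose (p - 1)) - 1) (P * t / w - 1)"
    unfolding P_def w_def using gbinomial_p_mult_shift[OF t, of r] Suc.prems
    by (intro rat_cong_diff rat_cong_refl) auto
  from rat_cong_scale[OF d(2) this]
  have "rat_cong p 2 (((P * t + of_nat r gchoose (p - 1)) - 1) / d) (1 / d * (P * t / w - 1))"
    by simp
  also have "rat_cong p 2 (1 / d * (P * t / w - 1)) (- (1 / w) + 2 * P * t * (1 / w ^ 2))"
  proof (rule rat_congI[of _ "- (2 * t ^ 2 * (1 / w ^ 2) * (1 / d))", folded P_def])
    show "1 / d * (P * t / w - 1) = - (1 / w) + 2 * P * t * (1 / w ^ 2) +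
        P ^ 2 * - (2 * t ^ 2 * (1 / w ^ 2) * (1 / d))"
    proof -
      define u e where "u = 1 / w" and "e = 1 / d"
      have "u * w = 1" "e * d = 1" using w(1) d(1) by (simp_all add: u_def e_def)
      have "- u + 2 * P * t * u ^ 2 = (e * d) * (- u + 2 * P * t * u ^ 2)"
        by (simp add: \<open>e * d = 1\<close>)
      also have "\<dots> = e * (- P * t * u - u * w + 2 * P ^ 2 * t ^ 2 * u ^ 2 + 2 * P * t * u * (u * w))"
        by (simp add: dw algebra_simps power2_eq_square)
      also have "\<dots> = e * (P * t * u - 1) + P ^ 2 * (2 * t ^ 2 * u ^ 2 * e)"
        unfolding \<open>u * w = 1\<close> by (simp add: algebra_simps)
      finally show ?thesis by (simp add: u_def e_def power_one_over)
    qed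
    show "p_integral p (- (1 / w) + 2 * P * t * (1 / w ^ 2))"
      unfolding P_def
      by (intro p_integral_add p_integral_minus p_integral_mult w t p_integral_of_nat p_integral_numeral)
    show "p_integral p (- (2 * t ^ 2 * (1 / w ^ 2) * (1 / d)))"
      by (intro p_integral_add p_integral_minus p_integral_mult p_integral_power w t d p_integral_numeral)
  qed
  finally have 2: "rat_cong p 2 (((P * t + of_nat r gchoose (p - 1)) - 1) / d)
      (- (1 / w) + 2 * P * t * (1 / w ^ 2))" .
  have "rat_cong p 2 (altsum (p - 1) (P * t + of_nat r)) (- hsum 1 r + 2 * P * t * hsum 2 r)"
    unfolding P_def using Suc by simp
  from rat_cong_add[OF this 2]
  have "rat_cong p 2 (altsum (p - 1) d)
    (- hsum 1 r + 2 * P * t * hsum 2 r + (- (1 / w) + 2 * P * t * (1 / w ^ 2)))"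
    by (simp only: 1)
  moreover have "- hsum 1 r + 2 * P * t * hsum 2 r + (- (1 / w) + 2 * P * t * (1 / w ^ 2)) =
      - hsum 1 (Suc r) + 2 * P * t * hsum 2 (Suc r)"
    by (simp add: hsum_Suc w_def ring_distribs)
  ultimately show ?case unfolding dw P_def w_def by (simp only:)
qed

end

section \<open>The Fermat quotient of 3\<close>

context prime_gt3
begin

text \<open>The coefficient of \<open>p ^ 2\<close> is the second elementary symmetric function,
  expressed by power sums. In the induction the only surplus is cubic in \<open>p\<close>.\<close>

lemma prod_one_minus_p_mult:
  assumes "finite A" "\<And>i. i \<in> A \<Longrightarrow> p_integral p (x i)"
  shows "rat_cong p 3 (\<Prod>i\<in>A. 1 - of_nat p * x i)
    (1 - of_nat p * sum x A + of_nat p ^ 2 * ((sum x A) ^ 2 - (\<Sum>i\<in>A. x i ^ 2)) / 2)"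
  using assms
proof (induction A rule: finite_induct)
  case empty
  then show ?case by (auto intro!: rat_cong_refl)
next
  case (insert a A)
  define P :: rat where "P = of_nat p"
  define s q where "s = sum x A" and "q = (\<Sum>i\<in>A. x i ^ 2)"
  have h: "p_integral p (1 / 2)"
    using p_integral_divide_less[of 2 1] gt3 by simp
  have i: "p_integral p s" "p_integral p q" "p_integral p (x a)" "p_integral p P"
    unfolding s_def q_def P_def using insert.prems by auto
  have "rat_cong p 3 (\<Prod>i\<in>A. 1 - P * x i) (1 - P * s + P ^ 2 * (s ^ 2 - q) / 2)"
    unfolding s_def q_def P_def using insert by simp
  moreover have "rat_cong p 3 (1 - P * x a) (1 - P * x a)"
    by (intro rat_cong_refl p_integral_diff p_integral_mult i p_integral_1)
  ultimately have "rat_cong p 3 ((1 - P * x a) * (\<Prod>i\<in>A. 1 - P * x i))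
      ((1 - P * x a) * (1 - P * s + P ^ 2 * (s ^ 2 - q) / 2))"
    by (rule rat_cong_mult[rotated])
  also have "rat_cong p 3 \<dots> (1 - P * (x a + s) + P ^ 2 * ((x a + s) ^ 2 - (x a ^ 2 + q)) / 2)"
  proof (rule rat_congI[of _ "- (x a * ((s ^ 2 - q) * (1 / 2)))", folded P_def])
    show "(1 - P * x a) * (1 - P * s + P ^ 2 * (s ^ 2 - q) / 2) =
        1 - P * (x a + s) + P ^ 2 * ((x a + s) ^ 2 - (x a ^ 2 + q)) / 2 +
        P ^ 3 * - (x a * ((s ^ 2 - q) * (1 / 2)))"
      by (simp add: field_simps power2_eq_square power3_eq_cube)
    show "p_integral p (- (x a * ((s ^ 2 - q) * (1 / 2))))"
      by (intro p_integral_minus p_integral_mult p_integral_diff p_integral_power i h)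
    have "p_integral p (1 - P * (x a + s) + P ^ 2 * ((x a + s) ^ 2 - (x a ^ 2 + q)) * (1 / 2))"
      by (intro p_integral_add p_integral_mult p_integral_diff p_integral_power i h p_integral_1)
    then show "p_integral p (1 - P * (x a + s) + P ^ 2 * ((x a + s) ^ 2 - (x a ^ 2 + q)) / 2)"
      by simp
  qed
  finally show ?case using insert(1,2) by (simp add: s_def q_def P_def)
qed

text \<open>Each residue is \<open>c * k - p * (c * k div p)\<close>. Since the residues are a
  permutation of \<open>1, ..., p - 1\<close>, the common product \<open>(p - 1)!\<close>
  cancels.\<close>

lemma prod_mult_mod:
  assumes "\<not> p dvd c"
  shows "of_nat c ^ (p - 1) *
    (\<Prod>k = 1..p - 1. 1 - of_nat p * (of_nat (c * k div p) / (of_nat c * of_nat k))) = (1 :: rat)"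
proof -
  have c: "c \<noteq> 0" using assms by (cases "c = 0") auto
  have "(\<Prod>k = 1..p - 1. of_nat ((c * k) mod p)) = (\<Prod>k = 1..p - 1. rat_of_nat k)"
    by (rule prod.reindex_bij_betw[OF bij_betw_mult_mod[OF assms]])
  moreover have "(\<Prod>k = 1..p - 1. rat_of_nat ((c * k) mod p)) =
      (\<Prod>k = 1..p - 1. of_nat c * of_nat k * (1 - of_nat p * (of_nat (c * k div p) / (of_nat c * of_nat k))))"
  proof (rule prod.cong)
    fix k assume k: "k \<in> {1..p - 1}"
    have "rat_of_nat ((c * k) mod p) + of_nat p * of_nat (c * k div p) = of_nat c * of_nat k"
      unfolding of_nat_mult[symmetric] of_nat_add[symmetric] by simp
    moreover have "of_nat c * of_nat k * (1 - of_nat p * (of_nat (c * k div p) / (of_nat c * of_nat k)))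
        = of_nat c * of_nat k - of_nat p * rat_of_nat (c * k div p)"
      using k c by (simp add: right_diff_distrib)
    ultimately show "rat_of_nat ((c * k) mod p) =
        of_nat c * of_nat k * (1 - of_nat p * (of_nat (c * k div p) / (of_nat c * of_nat k)))"
      by simp
  qed simp
  ultimately have "(\<Prod>k = 1..p - 1. rat_of_nat k) * (of_nat c ^ (p - 1) *
      (\<Prod>k = 1..p - 1. 1 - of_nat p * (of_nat (c * k div p) / (of_nat c * of_nat k)))) =
      (\<Prod>k = 1..p - 1. rat_of_nat k)"
    by (simp add: prod.distrib mult_ac)
  moreover have "(\<Prod>k = 1..p - 1. rat_of_nat k) \<noteq> 0" by auto
  ultimately show ?thesis by simp
qed

lemma fermat_quotient_of_int:
  assumes "\<not> p dvd a"
  obtains z where "fermat_quotient p a = of_int z"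
proof -
  have "[a ^ (p - 1) = 1] (mod p)"
    using fermat_theorem[OF prime_p assms] .
  then have "int p dvd int (a ^ (p - 1)) - 1"
    using cong_iff_dvd_diff cong_int_iff by (metis of_nat_1)
  then obtain z where "int (a ^ (p - 1)) - 1 = int p * z" by blast
  then have "rat_of_int (int (a ^ (p - 1)) - 1) = rat_of_int (int p * z)" by simp
  then have "fermat_quotient p a = of_int z"
    using p_pos by (simp add: fermat_quotient_def)
  then show thesis by (rule that)
qed

text \<open>The quotient jumps at \<open>p / 3\<close> and \<open>2 * p / 3\<close>. As 3 does not
  divide \<open>p\<close>, the floor of \<open>2 * p / 3\<close> is \<open>p - 1 - p div 3\<close>,
  which prepares the reflection lemmas.\<close>

lemma three_mult_div:
  assumes "k \<in> {1..p - 1}"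
  shows "3 * k div p = (if k \<le> p div 3 then 0 else if k \<le> p - 1 - p div 3 then 1 else 2)"
proof -
  have "\<not> 3 dvd p" using prime_p gt3 prime_nat_iff by force
  then have m: "p mod 3 = 1 \<or> p mod 3 = 2" by presburger
  have p: "p = 3 * (p div 3) + p mod 3" by simp
  have k: "1 \<le> k" "k < p" using assms by auto
  consider "3 * k < p" | "p \<le> 3 * k" "3 * k < 2 * p" | "2 * p \<le> 3 * k" "3 * k < 3 * p"
    using k by linarith
  then show ?thesis
  proof cases
    case 1
    then show ?thesis using m by auto
  next
    case 2
    then have "3 * k div p = 1" by (intro div_nat_eqI) auto
    moreover have "3 * k \<noteq> p" using \<open>\<not> 3 dvd p\<close> by auto
    ultimately show ?thesis using m p 2 by auto
  next
    case 3
    then have "3 * k div p = 2" by (intro div_nat_eqI) auto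
    then show ?thesis using m p 3 by auto
  qed
qed

text \<open>The step function \<open>g (3 * k div p)\<close> is the constant \<open>g 2\<close>
  minus multiples of two indicators of initial segments. It is applied to the identity and to the
  square.\<close>

lemma sum_three_mult_div:
  fixes f :: "nat \<Rightarrow> rat" and g :: "nat \<Rightarrow> rat"
  assumes "g 0 = 0"
  shows "(\<Sum>k = 1..p - 1. g (3 * k div p) * f k) = g 2 * (\<Sum>k = 1..p - 1. f k)
    - g 1 * (\<Sum>k = 1..p div 3. f k) - (g 2 - g 1) * (\<Sum>k = 1..p - 1 - p div 3. f k)"
proof -
  let ?m = "p div 3"
  let ?M = "p - 1 - p div 3"
  have o: "?m \<le> ?M" "?M \<le> p - 1" by auto
  have sub: "(\<Sum>k = 1..p - 1. if k \<le> n then f k else 0) = (\<Sum>k = 1..n. f k)" if "n \<le> p - 1" for n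
    by (rule sum.mono_neutral_cong_right) (use that in auto)
  have "(\<Sum>k = 1..p - 1. g (3 * k div p) * f k) = (\<Sum>k = 1..p - 1. g 2 * f k -
      g 1 * (if k \<le> ?m then f k else 0) - (g 2 - g 1) * (if k \<le> ?M then f k else 0))"
  proof (rule sum.cong)
    fix k assume "k \<in> {1..p - 1}"
    from three_mult_div[OF this] show "g (3 * k div p) * f k = g 2 * f k -
        g 1 * (if k \<le> ?m then f k else 0) - (g 2 - g 1) * (if k \<le> ?M then f k else 0)"
      using assms o by (auto simp: left_diff_distrib)
  qed simp
  also have "\<dots> = g 2 * (\<Sum>k = 1..p - 1. f k) - g 1 * (\<Sum>k = 1..p - 1. if k \<le> ?m then f k else 0) -
      (g 2 - g 1) * (\<Sum>k = 1..p - 1. if k \<le> ?M then f k else 0)"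
    by (simp only: sum_subtractf sum_distrib_left)
  also have "\<dots> = g 2 * (\<Sum>k = 1..p - 1. f k) - g 1 * (\<Sum>k = 1..?m. f k) - (g 2 - g 1) * (\<Sum>k = 1..?M. f k)"
    using sub[of ?m] sub[of ?M] o by simp
  finally show ?thesis .
qed

text \<open>
  Multiplication by 3 permutes the nonzero residues, so
  \<open>3 ^ (p - 1) * (\<Prod>k. 1 - p * (3 * k div p) / (3 * k)) = 1\<close>. Expanding modulo \<open>p ^ 3\<close>
  leaves \<open>Y = (\<Sum>k. (3 * k div p) / k)\<close> and \<open>Z = (\<Sum>k. (3 * k div p)\<^sup>2 / k\<^sup>2)\<close>.
\<close>

lemma hsum_third:
  fixes m :: nat and q :: rat
  defines "m \<equiv> p div 3" and "q \<equiv> fermat_quotient p 3"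
  shows "rat_cong p 2 (hsum 1 m)
    (- 3 / 2 * q + 3 / 4 * of_nat p * q ^ 2 - of_nat p / 3 * hsum 2 m)"
proof -
  define P :: rat where "P = of_nat p"
  define h h2 where "h = hsum 1 m" and "h2 = hsum 2 m"
  define Y where "Y = (\<Sum>k = 1..p - 1. of_nat (3 * k div p) * (1 / rat_of_nat k ^ 1))"
  define Z where "Z = (\<Sum>k = 1..p - 1. (of_nat (3 * k div p)) ^ 2 * (1 / rat_of_nat k ^ 2))"
  define x where "x k = rat_of_nat (3 * k div p) / (of_nat 3 * of_nat k)" for k
  have m: "m < p" using p_pos by (simp add: m_def)
  have n3: "\<not> p dvd 3" and n2: "\<not> p dvd 2" using not_dvd_less[of 3] not_dvd_less[of 2] gt3 by auto
  have half: "p_integral p (1 / 2)" using p_integral_divide_of_nat[OF n2, of 1] by simp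
  have third: "p_integral p (1 / 3)" using p_integral_divide_of_nat[OF n3, of 1] by simp
  have P: "P \<noteq> 0" "p_integral p P" using p_pos by (auto simp: P_def)
  have q: "p_integral p q" unfolding q_def
    using fermat_quotient_of_int[OF n3] by (metis p_integral_of_int)
  have hh: "p_integral p h" "p_integral p h2" unfolding h_def h2_def using m by auto
  have Yc: "rat_cong p 2 Y (- 2 * h - P * h2)"
  proof -
    have "Y = 2 * hsum 1 (p - 1) - hsum 1 m - hsum 1 (p - 1 - m)"
      unfolding Y_def hsum_def m_def by (subst sum_three_mult_div) auto
    also have "rat_cong p 2 \<dots> (2 * 0 - hsum 1 m - (hsum 1 m + of_nat p * hsum 2 m))"
      by (intro rat_cong_diff rat_cong_scale hsum_1_p hsum_1_reflect rat_cong_refl)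
        (use m in auto)
    also have "\<dots> = - 2 * h - P * h2" by (simp add: h_def h2_def P_def)
    finally show ?thesis .
  qed
  have Zc: "rat_cong p 1 Z (2 * h2)"
  proof -
    have "Z = 4 * hsum 2 (p - 1) - hsum 2 m - 3 * hsum 2 (p - 1 - m)"
      unfolding Z_def hsum_def m_def by (subst sum_three_mult_div[where g = "\<lambda>n. of_nat n ^ 2"]) auto
    also have "rat_cong p 1 \<dots> (4 * 0 - hsum 2 m - 3 * - hsum 2 m)"
      by (intro rat_cong_diff rat_cong_scale hsum_2_p hsum_2_reflect rat_cong_refl)
        (use m in auto)
    also have "\<dots> = 2 * h2" by (simp add: h2_def)
    finally show ?thesis .
  qed
  have xi: "p_integral p (x k)" if "k \<in> {1..p - 1}" for k
  proof -
    have "\<not> p dvd k" using that by (intro not_dvd_less) auto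
    then show ?thesis
      unfolding x_def of_nat_mult[symmetric] using n3 prime_p
      by (intro p_integral_divide_of_nat p_integral_of_nat) (simp add: prime_dvd_mult_iff)
  qed
  have sx: "sum x {1..p - 1} = Y / 3"
    by (simp add: x_def Y_def sum_divide_distrib field_simps)
  have sx2: "(\<Sum>k = 1..p - 1. x k ^ 2) = Z / 9"
    by (simp add: x_def Z_def sum_divide_distrib field_simps)
  have "rat_cong p 3 (\<Prod>k = 1..p - 1. 1 - P * x k)
      (1 - P * (Y / 3) + P ^ 2 * ((Y / 3) ^ 2 - Z / 9) / 2)"
    unfolding P_def using prod_one_minus_p_mult[where A = "{1..p - 1}" and x = x, OF finite_atLeastAtMost xi] unfolding sx sx2 .
  moreover have e: "3 ^ (p - 1) = 1 + P * q"
    using P by (simp add: q_def fermat_quotient_def P_def)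
  have "(1 + P * q) * (\<Prod>k = 1..p - 1. 1 - P * x k) = 1"
    using prod_mult_mod[OF n3] unfolding e[symmetric] by (simp add: P_def x_def)
  ultimately obtain z where z: "p_integral p z"
    "(1 + P * q) * (1 - P * (Y / 3) + P ^ 2 * ((Y / 3) ^ 2 - Z / 9) / 2 + P ^ 3 * z) = 1"
    unfolding P_def by (metis rat_congE)
  obtain y where y: "p_integral p y" "Y = - 2 * h - P * h2 + P ^ 2 * y"
    using Yc rat_congE unfolding P_def by blast
  obtain w where w: "p_integral p w" "Z = 2 * h2 + P * w"
    using Zc rat_congE unfolding P_def by (metis power_one_right)
  have Yi: "p_integral p Y" "p_integral p Z"
    using Yc Zc rat_cong_integral by blast+
  \<comment> \<open>\<open>T\<close> is the second elementary symmetric function of the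
    \<open>x k\<close>.\<close>
  define T where "T = ((Y * (1 / 3)) ^ 2 - Z * (1 / 3) * (1 / 3)) * (1 / 2)"
  have T: "p_integral p T"
    unfolding T_def by (intro p_integral_mult p_integral_power p_integral_diff Yi third half)
  have "P * (q - Y * (1 / 3) + P * T - P * q * (Y * (1 / 3)) + P ^ 2 * (z + q * T + P * q * z)) = 0"
  proof -
    have "P ^ 2 * ((Y / 3) ^ 2 - Z / 9) / 2 = P ^ 2 * T" "Y / 3 = Y * (1 / 3)"
      by (simp_all add: T_def power2_eq_square)
    then have "(1 + P * q) * (1 - P * (Y * (1 / 3)) + P ^ 2 * T + P ^ 3 * z) = 1"
      using z(2) by (simp only:)
    then show ?thesis by (simp add: algebra_simps power2_eq_square power3_eq_cube)
  qed
  \<comment> \<open>Cancelling one factor \<open>P\<close> is why the product was expanded modulo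
    \<open>p ^ 3\<close>: precision \<open>p ^ 2\<close> remains.\<close>
  then have main: "q - Y * (1 / 3) + P * T - P * q * (Y * (1 / 3)) + P ^ 2 * (z + q * T + P * q * z) = 0"
    by (simp only: mult_eq_0_iff P(1) simp_thms)
  define A where "A = z + q * T + P * q * z"
  define v where "v = - (T - q * (Y * (1 / 3)) + P * A)"
  have A: "p_integral p A" unfolding A_def
    by (intro p_integral_mult p_integral_add T q P z)
  have v: "p_integral p v" unfolding v_def
    by (intro p_integral_minus p_integral_mult p_integral_add p_integral_diff T q Yi P A third)
  have main: "q - Y * (1 / 3) + P * T - P * q * (Y * (1 / 3)) + P ^ 2 * A = 0"
    using main by (simp add: A_def)
  \<comment> \<open>Modulo \<open>p\<close> the relation says \<open>Y / 3 = q\<close>. This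
    suffices inside \<open>T\<close> and in the other term carrying \<open>P\<close>.\<close>
  have qv: "Y * (1 / 3) = q - P * v"
    using main by (simp add: v_def algebra_simps power2_eq_square)
  define B where "B = - q * v + P * v ^ 2 * (1 / 2) - w * (1 / 3) * (1 / 3) * (1 / 2)"
  have B: "p_integral p B" unfolding B_def
    by (intro p_integral_minus p_integral_mult p_integral_add p_integral_diff p_integral_power
        q v P w third half)
  have TB: "T = q ^ 2 * (1 / 2) - h2 * (1 / 3) * (1 / 3) + P * B"
    unfolding T_def qv w(2) by (simp add: B_def field_simps power2_eq_square)
  have "P * q * (Y * (1 / 3)) = P * q * (q - P * v)" by (simp only: qv)
  then have main: "q - Y * (1 / 3) + P * (q ^ 2 * (1 / 2) - h2 * (1 / 3) * (1 / 3) + P * B)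
      - P * q * (q - P * v) + P ^ 2 * A = 0"
    using main unfolding TB by (simp only:)
  show ?thesis unfolding h_def[symmetric] h2_def[symmetric] P_def[symmetric]
  \<comment> \<open>Solving \<open>main\<close> for \<open>h\<close> after
    \<open>Y = - 2 * h - P * h2 + P ^ 2 * y\<close> leaves this as the coefficient of
    \<open>P ^ 2\<close>.\<close>
  proof (rule rat_congI[of _ "3 * (1 / 2) * (y * (1 / 3) - B - q * v - A)", folded P_def])
    show "h = - 3 / 2 * q + 3 / 4 * P * q ^ 2 - P / 3 * h2 +
        P ^ 2 * (3 * (1 / 2) * (y * (1 / 3) - B - q * v - A))"
      using main y(2) by (simp add: field_simps power2_eq_square)
    show "p_integral p (3 * (1 / 2) * (y * (1 / 3) - B - q * v - A))"
      by (intro p_integral_mult p_integral_diff y B q v A third half p_integral_numeral)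
    have "p_integral p (- 3 * (1 / 2) * q + 3 * (1 / 2) * (1 / 2) * P * q ^ 2 - P * (1 / 3) * h2)"
      by (intro p_integral_mult p_integral_add p_integral_diff p_integral_power p_integral_minus
          q P hh third half p_integral_numeral)
    then show "p_integral p (- 3 / 2 * q + 3 / 4 * P * q ^ 2 - P / 3 * h2)" by simp
  qed
qed

end

section \<open>The Appell polynomials of \<open>U\<close>\<close>

definition upoly :: "nat \<Rightarrow> rat \<Rightarrow> rat" where
  "upoly n x = (\<Sum>k\<le>n. of_nat (n choose k) * of_int (U k) * x ^ (n - k))"

definition u_fps :: "rat fps" where
  "u_fps = Abs_fps (\<lambda>n. of_int (U n) / fact n)"

lemma U_rec: "n > 0 \<Longrightarrow> U n + 2 * (\<Sum>k = 1..n div 2. int (n choose (2 * k)) * U (n - 2 * k)) = 0"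
  by (subst U.simps) simp

text \<open>The recurrence links only indices of equal parity, and the initial value sits at the
  even index 0.\<close>

lemma U_odd: "odd n \<Longrightarrow> U n = 0"
proof (induction n rule: less_induct)
  case (less n)
  then have "n > 0" by (auto elim: oddE)
  moreover have "(\<Sum>k = 1..n div 2. int (n choose (2 * k)) * U (n - 2 * k)) = 0"
  proof (rule sum.neutral, rule ballI)
    fix k assume k: "k \<in> {1..n div 2}"
    then have "n - 2 * k < n" "odd (n - 2 * k)" using less.prems by auto
    then show "int (n choose (2 * k)) * U (n - 2 * k) = 0" using less.IH by simp
  qed
  ultimately show ?case using U_rec[of n] by simp
qed

lemma sum_even_reindex:
  fixes g :: "nat \<Rightarrow> rat"
  shows "(\<Sum>j = 1..n. if even j then g j else 0) = (\<Sum>k = 1..n div 2. g (2 * k))"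
proof -
  have "(\<Sum>j = 1..n. if even j then g j else 0) = (\<Sum>j \<in> {j \<in> {1..n}. even j}. g j)"
    by (rule sum.inter_filter[symmetric]) simp
  also have "\<dots> = (\<Sum>k = 1..n div 2. g (2 * k))"
    by (rule sum.reindex_bij_witness[of _ "\<lambda>k. 2 * k" "\<lambda>j. j div 2"]) auto
  finally show ?thesis .
qed

text \<open>The second factor has constant term 1, coefficients \<open>2 / fact j\<close> at even
  \<open>j > 0\<close> and 0 at odd \<open>j\<close>. Coefficient \<open>n\<close> of the product is
  thus the recurrence for \<open>U n\<close> divided by \<open>fact n\<close>.\<close>

lemma u_fps_mult: "u_fps * (fps_exp 1 + fps_exp (- 1) - 1) = 1"
proof (rule fps_ext)
  fix n
  define g :: "nat \<Rightarrow> rat" where "g j = (1 + (- 1) ^ j) / fact j - (if j = 0 then 1 else 0)" for j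
  have "g 0 = 1" by (simp add: g_def)
  have "fps_nth (u_fps * (fps_exp 1 + fps_exp (- 1) - 1)) n = (\<Sum>j = 0..n. of_int (U j) / fact j * g (n - j))"
    by (simp add: fps_mult_nth u_fps_def g_def add_divide_distrib)
  also have "\<dots> = (\<Sum>j = 0..n. of_int (U (n - j)) / fact (n - j) * g j)"
    by (rule sum.reindex_bij_witness[of _ "\<lambda>j. n - j" "\<lambda>j. n - j"]) auto
  also have "\<dots> = of_int (U n) / fact n + (\<Sum>j = 1..n. of_int (U (n - j)) / fact (n - j) * g j)"
    by (simp add: sum.atLeast_Suc_atMost \<open>g 0 = 1\<close>)
  also have "(\<Sum>j = 1..n. of_int (U (n - j)) / fact (n - j) * g j) =
      (\<Sum>j = 1..n. if even j then 2 / fact n * (of_nat (n choose j) * of_int (U (n - j))) else 0)"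
  proof (rule sum.cong)
    fix j assume "j \<in> {1..n}"
    then show "of_int (U (n - j)) / fact (n - j) * g j =
        (if even j then 2 / fact n * (of_nat (n choose j) * of_int (U (n - j))) else 0)"
      by (auto simp: g_def binomial_fact mult_ac)
  qed simp
  also have "\<dots> = 2 / fact n * (\<Sum>k = 1..n div 2. of_nat (n choose (2 * k)) * of_int (U (n - 2 * k)))"
    by (simp only: sum_even_reindex sum_distrib_left)
  also have "of_int (U n) / fact n + \<dots> =
      of_int (U n + 2 * (\<Sum>k = 1..n div 2. int (n choose (2 * k)) * U (n - 2 * k))) / fact n"
    by (simp add: add_divide_distrib)
  also have "\<dots> = fps_nth 1 n"
    using U_rec[of n] by (cases "n = 0") (auto simp: U.simps[of 0])
  finally show "fps_nth (u_fps * (fps_exp 1 + fps_exp (- 1) - 1)) n = fps_nth 1 n" .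
qed

lemma upoly_fps: "fps_nth (u_fps * fps_exp x) n = upoly n x / fact n"
proof -
  have "fps_nth (u_fps * fps_exp x) n = (\<Sum>k = 0..n. of_int (U k) / fact k * (x ^ (n - k) / fact (n - k)))"
    by (simp add: fps_mult_nth u_fps_def)
  also have "\<dots> = (\<Sum>k = 0..n. of_nat (n choose k) * of_int (U k) * x ^ (n - k) / fact n)"
    by (rule sum.cong) (auto simp: binomial_fact)
  finally show ?thesis
    by (simp add: upoly_def sum_divide_distrib atMost_atLeast0)
qed

lemma upoly_three_term: "upoly n (x + 1) + upoly n (x - 1) - upoly n x = x ^ n"
proof -
  have "u_fps * fps_exp (x + 1) + u_fps * fps_exp (x - 1) - u_fps * fps_exp x =
      u_fps * (fps_exp 1 + fps_exp (- 1) - 1) * fps_exp x"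
    using fps_exp_add_mult[of x 1] fps_exp_add_mult[of x "- 1"] by (simp add: algebra_simps)
  also have "\<dots> = fps_exp x" by (simp add: u_fps_mult)
  finally have "fps_nth (u_fps * fps_exp (x + 1) + u_fps * fps_exp (x - 1) - u_fps * fps_exp x) n =
      x ^ n / fact n" by simp
  then have "(upoly n (x + 1) + upoly n (x - 1) - upoly n x) / fact n = x ^ n / fact n"
    by (simp add: upoly_fps add_divide_distrib diff_divide_distrib)
  then show ?thesis by simp
qed

text \<open>The three-term relations at \<open>x + 1\<close> and \<open>x + 2\<close> add up and the
  middle values cancel, as in \<open>(z ^ 2 - z + 1) * (z + 1) = z ^ 3 + 1\<close>.\<close>

lemma upoly_shift_3: "upoly n (x + 3) + upoly n x = (x + 1) ^ n + (x + 2) ^ n"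
  using upoly_three_term[of n "x + 1"] upoly_three_term[of n "x + 2"] by (simp add: algebra_simps)

lemma upoly_shift_iterate:
  "(- 1) ^ N * upoly n (x + 3 * of_nat N) = upoly n x -
    (\<Sum>i<N. (- 1) ^ i * ((x + 3 * of_nat i + 1) ^ n + (x + 3 * of_nat i + 2) ^ n))"
proof (induction N)
  case 0
  then show ?case by simp
next
  case (Suc N)
  have "upoly n (x + 3 * of_nat (Suc N)) = (x + 3 * of_nat N + 1) ^ n + (x + 3 * of_nat N + 2) ^ n -
      upoly n (x + 3 * of_nat N)"
    using upoly_shift_3[of n "x + 3 * of_nat N"] by (simp add: algebra_simps)
  then have "(- 1) ^ Suc N * upoly n (x + 3 * of_nat (Suc N)) = (- 1) ^ N * upoly n (x + 3 * of_nat N) -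
      (- 1) ^ N * ((x + 3 * of_nat N + 1) ^ n + (x + 3 * of_nat N + 2) ^ n)"
    by (simp only:) (simp add: algebra_simps)
  then show ?case using Suc by simp
qed

lemma upoly_0: "upoly n 0 = of_int (U n)"
proof -
  have "upoly n 0 = (\<Sum>k\<le>n. if k = n then of_int (U n) else 0)"
    unfolding upoly_def by (rule sum.cong) (auto simp: power_0_left)
  then show ?thesis by simp
qed

lemma upoly_even:
  assumes "even n"
  shows "upoly n (- x) = upoly n x"
  unfolding upoly_def
proof (rule sum.cong)
  fix k assume "k \<in> {..n}"
  then show "of_nat (n choose k) * of_int (U k) * (- x) ^ (n - k) =
      of_nat (n choose k) * of_int (U k) * x ^ (n - k)"
    using assms U_odd[of k] by (cases "even k") auto
qed simp

text \<open>At \<open>x = 0\<close> the three-term relation reads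
  \<open>2 * upoly n 1 - U n = 0 ^ n\<close> by evenness, and \<open>0 ^ n = 0\<close> for positive
  \<open>n\<close>.\<close>

lemma upoly_pm1:
  assumes "even n" "n > 0"
  shows "upoly n 1 = of_int (U n) / 2" "upoly n (- 1) = of_int (U n) / 2"
  using upoly_three_term[of n 0] upoly_even[OF assms(1), of 1] assms(2) by (simp_all add: upoly_0 power_0_left)

section \<open>The residue of \<open>U (p - 3)\<close>\<close>

context prime_gt3
begin

lemma half_cong:
  assumes "rat_cong p 1 x (- x)"
  shows "rat_cong p 1 x 0"
proof -
  have "rat_cong p 1 (x + x) (- x + x)"
    using assms rat_cong_integral[OF assms] by (intro rat_cong_add rat_cong_refl) auto
  then have "rat_cong p 1 (of_nat 2 * x) (of_nat 2 * 0)" by simp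
  then show ?thesis by (rule rat_cong_cancel) (use not_dvd_less[of 2] gt3 in simp)
qed

text \<open>For even \<open>N\<close> the indices \<open>i\<close> and \<open>N - 1 - i\<close> have
  opposite parity, so reflection negates the sum modulo \<open>p\<close>.\<close>

lemma alternating_sum_reflect:
  assumes N: "even N" and g: "\<And>i. i < N \<Longrightarrow> rat_cong p 1 (g (N - 1 - i)) (g i)"
  shows "rat_cong p 1 (\<Sum>i<N. (- 1) ^ i * g i) 0"
proof (rule half_cong)
  have "(\<Sum>i<N. (- 1) ^ i * g i) = (\<Sum>i<N. (- 1) ^ (N - 1 - i) * g (N - 1 - i))"
    by (rule sum.reindex_bij_witness[of _ "\<lambda>i. N - 1 - i" "\<lambda>i. N - 1 - i"]) auto
  also have "\<dots> = (\<Sum>i<N. - ((- 1) ^ i) * g (N - 1 - i))"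
  proof (rule sum.cong)
    fix i assume "i \<in> {..<N}"
    then have "(- 1 :: rat) ^ (N - 1 - i) = - ((- 1) ^ i)"
      using N by (cases "even i") auto
    then show "(- 1) ^ (N - 1 - i) * g (N - 1 - i) = - ((- 1) ^ i) * g (N - 1 - i)" by simp
  qed simp
  also have "rat_cong p 1 \<dots> (\<Sum>i<N. - ((- 1) ^ i) * g i)"
    by (intro rat_cong_sum rat_cong_scale g p_integral_minus p_integral_power p_integral_1) auto
  also have "(\<Sum>i<N. - ((- 1) ^ i) * g i) = - (\<Sum>i<N. (- 1) ^ i * g i)"
    by (simp add: sum_negf)
  finally show "rat_cong p 1 (\<Sum>i<N. (- 1) ^ i * g i) (- (\<Sum>i<N. (- 1) ^ i * g i))" .
qed

section \<open>The Appell polynomial at \<open>p\<close> and powers with exponent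
  \<open>p - 3\<close>\<close>

lemma upoly_p: "rat_cong p 1 (upoly n (of_nat p)) (of_int (U n))"
proof -
  have "rat_cong p 1 (upoly n (of_nat p)) (upoly n 0)"
    unfolding upoly_def
    by (intro rat_cong_sum rat_cong_scale rat_cong_power rat_cong_p_0 p_integral_mult) auto
  then show ?thesis by (simp add: upoly_0)
qed

lemma power_p_minus_3:
  assumes "0 < a" "a < p"
  shows "rat_cong p 1 (of_nat a ^ (p - 3)) (1 / of_nat a ^ 2)"
proof -
  have "[a ^ (p - 1) = 1] (mod p)"
    using fermat_theorem[OF prime_p] not_dvd_less[OF assms] .
  then have "[int (a ^ (p - 1)) = int 1] (mod int p)" by (simp only: cong_int_iff)
  from rat_cong_of_int[OF this] have "rat_cong p 1 (of_nat a ^ (p - 1)) 1" by simp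
  from rat_cong_scale[OF p_integral_inverse_power[OF assms, of 2] this]
  have "rat_cong p 1 (1 / of_nat a ^ 2 * of_nat a ^ (p - 1)) (1 / of_nat a ^ 2)" by simp
  moreover have "1 / of_nat a ^ 2 * of_nat a ^ (p - 1) = rat_of_nat a ^ (p - 3)"
  proof -
    have "p - 1 = 2 + (p - 3)" using gt3 by simp
    then show ?thesis using assms(1) by (simp only: power_add) simp
  qed
  ultimately show ?thesis by (simp only:)
qed

lemma power_p_minus_3_reflect:
  assumes "a \<le> p"
  shows "rat_cong p 1 (of_nat (p - a) ^ (p - 3)) (of_nat a ^ (p - 3))"
proof -
  have "rat_cong p 1 (of_nat (p - a) ^ (p - 3)) ((- of_nat a) ^ (p - 3))"
    using assms by (intro rat_cong_power rat_congI[of _ 1]) (auto simp: of_nat_diff)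
  then show ?thesis using odd_p gt3 by simp
qed

lemma third_square:
  assumes "0 < i" "3 * i < p"
  shows "rat_cong p 1 (of_nat (3 * i) ^ (p - 3)) (1 / 9 * (1 / of_nat i ^ 2))"
  using power_p_minus_3[of "3 * i"] assms by (simp add: power_mult_distrib)

text \<open>From 1 to \<open>p = 3 * m + 1\<close> there are \<open>m\<close> steps of length 3, and
  \<open>m\<close> is even. The class \<open>3 * i + 2\<close> is mapped to itself by reflection, so
  \<open>S1\<close> vanishes; the multiples of 3 in \<open>S2\<close> give the inverse squares.
  Comparing both ends gives \<open>U (p - 3) / 2 = - (S1 + S2)\<close> modulo
  \<open>p\<close>.\<close>

lemma U_alternating_1:
  assumes "p mod 3 = 1"
  shows "rat_cong p 1 (of_int (U (p - 3)) / 2) (1 / 9 * (\<Sum>i = 1..p div 3. (- 1) ^ i / of_nat i ^ 2))"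
proof -
  define m where "m = p div 3"
  have p: "p = 3 * m + 1" using assms m_def by presburger
  have m: "even m" using odd_p p by simp
  have n: "even (p - 3)" "p - 3 > 0" using odd_p gt3 by auto
  have pe: "rat_of_nat p = 1 + 3 * of_nat m" using p by simp
  define S1 S2 where "S1 = (\<Sum>i<m. (- 1) ^ i * rat_of_nat (3 * i + 2) ^ (p - 3))"
    and "S2 = (\<Sum>i<m. (- 1) ^ i * rat_of_nat (3 * (i + 1)) ^ (p - 3))"
  have "upoly (p - 3) (of_nat p) = of_int (U (p - 3)) / 2 -
      (\<Sum>i<m. (- 1) ^ i * ((1 + 3 * of_nat i + 1) ^ (p - 3) + (1 + 3 * of_nat i + 2) ^ (p - 3)))"
    using upoly_shift_iterate[of m "p - 3" 1] m upoly_pm1[OF n] by (simp add: pe)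
  also have "\<dots> = of_int (U (p - 3)) / 2 - (S1 + S2)"
    by (simp add: S1_def S2_def sum.distrib ring_distribs)
  finally have 1: "rat_cong p 1 (of_int (U (p - 3)) / 2 - (S1 + S2)) (of_int (U (p - 3)))"
    using upoly_p[of "p - 3"] by simp
  have 2: "rat_cong p 1 S1 0"
    unfolding S1_def
  proof (rule alternating_sum_reflect[OF m])
    fix i assume "i < m"
    then have "3 * (m - 1 - i) + 2 = p - (3 * i + 2)" "3 * i + 2 \<le> p" using p by auto
    then show "rat_cong p 1 (of_nat (3 * (m - 1 - i) + 2) ^ (p - 3)) (of_nat (3 * i + 2) ^ (p - 3))"
      using power_p_minus_3_reflect[of "3 * i + 2"] by (simp only:)
  qed
  have "rat_cong p 1 S2 (\<Sum>i<m. (- 1) ^ i * (1 / 9 * (1 / of_nat (i + 1) ^ 2)))"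
    unfolding S2_def
    by (intro rat_cong_sum rat_cong_scale third_square p_integral_power p_integral_minus p_integral_1)
      (use p in auto)
  \<comment> \<open>The index shift by one flips every sign, which cancels the minus in
    \<open>- (S1 + S2)\<close>.\<close>
  also have "(\<Sum>i<m. (- 1) ^ i * (1 / 9 * (1 / of_nat (i + 1) ^ 2))) =
      (\<Sum>i = 1..m. - (1 / 9 * ((- 1) ^ i / rat_of_nat i ^ 2)))"
    by (rule sum.reindex_bij_witness[of _ "\<lambda>i. i - 1" "\<lambda>i. i + 1"]) auto
  also have "\<dots> = - (1 / 9 * (\<Sum>i = 1..m. (- 1) ^ i / of_nat i ^ 2))"
    by (simp only: sum_negf sum_distrib_left)
  finally have 3: "rat_cong p 1 S2 (- (1 / 9 * (\<Sum>i = 1..m. (- 1) ^ i / of_nat i ^ 2)))" .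
  have h: "p_integral p (of_int (U (p - 3)) / 2)"
    using p_integral_divide_less[of 2 "of_int (U (p - 3))"] gt3 by simp
  have "rat_cong p 1 (of_int (U (p - 3)) - of_int (U (p - 3)) / 2)
      (of_int (U (p - 3)) / 2 - (S1 + S2) - of_int (U (p - 3)) / 2)"
    by (rule rat_cong_diff[OF rat_cong_sym[OF 1] rat_cong_refl[OF h]])
  then have "rat_cong p 1 (of_int (U (p - 3)) / 2) (- (S1 + S2))" by simp
  also have "rat_cong p 1 (- (S1 + S2)) (- (0 + - (1 / 9 * (\<Sum>i = 1..m. (- 1) ^ i / of_nat i ^ 2))))"
    by (intro rat_cong_minus rat_cong_add 2 3)
  finally show ?thesis by (simp add: m_def)
qed

text \<open>Now the walk starts at \<open>- 1\<close> and takes \<open>m + 1\<close> steps, again an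
  even number. The class stable under reflection is \<open>3 * i + 1\<close>, and the multiples of 3
  appear without an index shift, whence the opposite sign.\<close>

lemma U_alternating_2:
  assumes "p mod 3 = 2"
  shows "rat_cong p 1 (of_int (U (p - 3)) / 2) (- (1 / 9 * (\<Sum>i = 1..p div 3. (- 1) ^ i / of_nat i ^ 2)))"
proof -
  define m where "m = p div 3"
  have p: "p = 3 * m + 2" using assms m_def by presburger
  have m: "even (m + 1)" using odd_p p by simp
  have n: "even (p - 3)" "p - 3 > 0" using odd_p gt3 by auto
  have pe: "rat_of_nat p = - 1 + 3 * of_nat (m + 1)" using p by simp
  define S1 S2 where "S1 = (\<Sum>i<m + 1. (- 1) ^ i * rat_of_nat (3 * i + 1) ^ (p - 3))"
    and "S2 = (\<Sum>i<m + 1. (- 1) ^ i * rat_of_nat (3 * i) ^ (p - 3))"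
  have "upoly (p - 3) (of_nat p) = of_int (U (p - 3)) / 2 -
      (\<Sum>i<m + 1. (- 1) ^ i * ((- 1 + 3 * of_nat i + 1) ^ (p - 3) + (- 1 + 3 * of_nat i + 2) ^ (p - 3)))"
    using upoly_shift_iterate[of "m + 1" "p - 3" "- 1"] m upoly_pm1[OF n] unfolding pe by simp
  also have "\<dots> = of_int (U (p - 3)) / 2 - (S1 + S2)"
    by (simp add: S1_def S2_def sum.distrib ring_distribs)
  finally have 1: "rat_cong p 1 (of_int (U (p - 3)) / 2 - (S1 + S2)) (of_int (U (p - 3)))"
    using upoly_p[of "p - 3"] by simp
  have 2: "rat_cong p 1 S1 0"
    unfolding S1_def
  proof (rule alternating_sum_reflect[OF m])
    fix i assume "i < m + 1"
    then have "3 * (m + 1 - 1 - i) + 1 = p - (3 * i + 1)" "3 * i + 1 \<le> p" using p by auto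
    then show "rat_cong p 1 (of_nat (3 * (m + 1 - 1 - i) + 1) ^ (p - 3)) (of_nat (3 * i + 1) ^ (p - 3))"
      using power_p_minus_3_reflect[of "3 * i + 1"] by (simp only:)
  qed
  \<comment> \<open>The term \<open>i = 0\<close> is 0 because \<open>p - 3\<close> is
    positive.\<close>
  have "S2 = (\<Sum>i = 1..m. (- 1) ^ i * rat_of_nat (3 * i) ^ (p - 3))"
    unfolding S2_def using n by (intro sum.mono_neutral_right) (auto simp: not_less_eq_eq)
  also have "rat_cong p 1 \<dots> (\<Sum>i = 1..m. (- 1) ^ i * (1 / 9 * (1 / of_nat i ^ 2)))"
    by (intro rat_cong_sum rat_cong_scale third_square p_integral_power p_integral_minus p_integral_1)
      (use p in auto)
  also have "\<dots> = 1 / 9 * (\<Sum>i = 1..m. (- 1) ^ i / of_nat i ^ 2)"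
    unfolding sum_distrib_left by (rule sum.cong) auto
  finally have 3: "rat_cong p 1 S2 (1 / 9 * (\<Sum>i = 1..m. (- 1) ^ i / of_nat i ^ 2))" .
  have h: "p_integral p (of_int (U (p - 3)) / 2)"
    using p_integral_divide_less[of 2 "of_int (U (p - 3))"] gt3 by simp
  have "rat_cong p 1 (of_int (U (p - 3)) - of_int (U (p - 3)) / 2)
      (of_int (U (p - 3)) / 2 - (S1 + S2) - of_int (U (p - 3)) / 2)"
    by (rule rat_cong_diff[OF rat_cong_sym[OF 1] rat_cong_refl[OF h]])
  then have "rat_cong p 1 (of_int (U (p - 3)) / 2) (- (S1 + S2))" by simp
  also have "rat_cong p 1 (- (S1 + S2)) (- (0 + (1 / 9 * (\<Sum>i = 1..m. (- 1) ^ i / of_nat i ^ 2))))"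
    by (intro rat_cong_minus rat_cong_add 2 3)
  finally show ?thesis by (simp add: m_def)
qed

section \<open>Inverse squares up to \<open>p div 3\<close> and the Legendre symbol of -3\<close>

lemma p_mod_3: "p mod 3 = 1 \<or> p mod 3 = 2"
proof -
  have "\<not> 3 dvd p" using prime_p gt3 prime_nat_iff by force
  then show ?thesis by presburger
qed

text \<open>The bound \<open>(p - 1) div 2\<close> is fixed by the reflection of \<open>n\<close> to
  \<open>p - 1 - n\<close>, so the sum is congruent to its negative.\<close>

lemma hsum_2_half: "rat_cong p 1 (hsum 2 ((p - 1) div 2)) 0"
proof (rule half_cong)
  have "p - 1 - (p - 1) div 2 = (p - 1) div 2" using odd_p by (auto elim: oddE)
  then show "rat_cong p 1 (hsum 2 ((p - 1) div 2)) (- hsum 2 ((p - 1) div 2))"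
    using hsum_2_reflect[of "(p - 1) div 2"] gt3 by auto
qed

text \<open>
  Reflecting \<open>j \<mapsto> p - 2 * j\<close> identifies the odd \<open>i \<le> p div 3\<close> with
  \<open>p div 3 < j \<le> (p - 1) div 2\<close>.
\<close>

lemma odd_square_sum_third:
  defines "m \<equiv> p div 3"
  shows "rat_cong p 1 (\<Sum>i \<in> {i \<in> {1..m}. odd i}. 1 / of_nat i ^ 2) (- (1 / 4) * hsum 2 m)"
proof -
  define h where "h = (p - 1) div 2"
  have p: "p = 2 * h + 1" using odd_p by (auto simp: h_def elim: oddE)
  have mh: "m \<le> h" unfolding m_def h_def by presburger
  have mp: "p = 3 * m + 1 \<or> p = 3 * m + 2" using p_mod_3 unfolding m_def by presburger
  have quarter: "p_integral p (1 / 4)"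
    using p_integral_divide_of_nat[OF not_dvd_less[of 4], of 1] gt3 prime_p
    by (cases "p = 4") auto
  have "(\<Sum>i \<in> {i \<in> {1..m}. odd i}. 1 / rat_of_nat i ^ 2) = (\<Sum>j = m + 1..h. 1 / of_nat (p - 2 * j) ^ 2)"
  proof (rule sum.reindex_bij_witness[of _ "\<lambda>j. p - 2 * j" "\<lambda>i. (p - i) div 2"])
    fix i assume "i \<in> {i \<in> {1..m}. odd i}"
    then have i: "1 \<le> i" "i \<le> m" "odd i" by auto
    have "i \<le> p" using i mp by auto
    have "even (p - i)" using i(3) odd_p by simp
    then obtain j where j: "p - i = 2 * j" by (rule evenE)
    then have e: "(p - i) div 2 = j" "p = i + 2 * j" using \<open>i \<le> p\<close> by (simp, linarith)
    show "p - 2 * ((p - i) div 2) = i" using e by simp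
    then show "1 / rat_of_nat (p - 2 * ((p - i) div 2)) ^ 2 = 1 / of_nat i ^ 2" by simp
    have "m + 1 \<le> j" using mp
    proof
      assume "p = 3 * m + 1"
      then have "i \<noteq> m" using odd_p i(3) by auto
      then show ?thesis using e(2) i(2) \<open>p = 3 * m + 1\<close> by linarith
    qed (use e(2) i(2) in linarith)
    moreover have "j \<le> h" using e(2) p i(1) by linarith
    ultimately show "(p - i) div 2 \<in> {m + 1..h}" using e(1) by simp
  next
    fix j assume "j \<in> {m + 1..h}"
    then have j: "m + 1 \<le> j" "j \<le> h" by auto
    have e: "p = (p - 2 * j) + 2 * j" using j p by linarith
    show "(p - (p - 2 * j)) div 2 = j" using j p by simp
    have "odd (p - 2 * j)" using odd_p e by (metis even_add dvd_triv_left)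
    moreover have "1 \<le> p - 2 * j" using j p by linarith
    moreover have "p - 2 * j \<le> m" using j(1) mp by linarith
    ultimately show "p - 2 * j \<in> {i \<in> {1..m}. odd i}" by simp
  qed
  \<comment> \<open>The factor \<open>1 / 4\<close> now comes out, and the remaining range is the
    difference of the half sum, which vanishes, and the sum up to \<open>m\<close>.\<close>
  also have "rat_cong p 1 \<dots> (\<Sum>j = m + 1..h. 1 / of_nat (2 * j) ^ 2)"
    by (intro rat_cong_sum inverse_square_reflect) (use p in auto)
  also have "(\<Sum>j = m + 1..h. 1 / of_nat (2 * j) ^ 2) = 1 / 4 * (\<Sum>j = m + 1..h. 1 / rat_of_nat j ^ 2)"
    by (simp add: sum_divide_distrib power_mult_distrib mult.commute)
  also have "(\<Sum>j = m + 1..h. 1 / rat_of_nat j ^ 2) = hsum 2 h - hsum 2 m"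
  proof -
    have "{1..h} = {1..m} \<union> {m + 1..h}" using mh by auto
    then have "hsum 2 h = (\<Sum>j \<in> {1..m} \<union> {m + 1..h}. 1 / rat_of_nat j ^ 2)" by (simp only: hsum_def)
    also have "\<dots> = hsum 2 m + (\<Sum>j = m + 1..h. 1 / rat_of_nat j ^ 2)"
      unfolding hsum_def by (rule sum.union_disjoint) auto
    finally show ?thesis by simp
  qed
  also have "rat_cong p 1 (1 / 4 * (hsum 2 h - hsum 2 m)) (1 / 4 * (0 - hsum 2 m))"
    using hsum_2_half p mh unfolding h_def
    by (intro rat_cong_scale quarter rat_cong_diff rat_cong_refl) auto
  finally show ?thesis by simp
qed

text \<open>The sign is 1 minus twice the indicator of odd \<open>i\<close>, and the odd part
  contributes \<open>- 1 / 4\<close> of the whole sum.\<close>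

lemma alternating_square_sum_third:
  defines "m \<equiv> p div 3"
  shows "rat_cong p 1 (\<Sum>i = 1..m. (- 1) ^ i / of_nat i ^ 2) (3 / 2 * hsum 2 m)"
proof -
  have "(\<Sum>i = 1..m. (- 1) ^ i / of_nat i ^ 2) =
      (\<Sum>i = 1..m. 1 / rat_of_nat i ^ 2 - 2 * (if odd i then 1 / of_nat i ^ 2 else 0))"
    by (rule sum.cong) auto
  also have "\<dots> = hsum 2 m - 2 * (\<Sum>i = 1..m. if odd i then 1 / of_nat i ^ 2 else 0)"
    by (simp only: sum_subtractf hsum_def sum_distrib_left)
  also have "(\<Sum>i = 1..m. if odd i then 1 / of_nat i ^ 2 else 0) =
      (\<Sum>i \<in> {i \<in> {1..m}. odd i}. 1 / rat_of_nat i ^ 2)"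
    by (rule sum.inter_filter[symmetric]) simp
  also have "rat_cong p 1 (hsum 2 m - 2 * \<dots>) (hsum 2 m - 2 * (- (1 / 4) * hsum 2 m))"
    using p_pos unfolding m_def
    by (intro rat_cong_diff rat_cong_scale rat_cong_refl odd_square_sum_third p_integral_hsum) auto
  finally show ?thesis by simp
qed

text \<open>Euler's criterion yields the symbol as \<open>(- 1) ^ h\<close> times that of 3, first
  modulo \<open>p\<close> and then exactly, since the values are at most 2 apart and
  \<open>p > 3\<close>. Reciprocity reduces to squares modulo 3.\<close>

lemma Legendre_minus_3: "Legendre (- 3) (int p) = (if p mod 3 = 1 then 1 else - 1)"
proof -
  define h where "h = (p - 1) div 2"
  have n0: "\<not> [3 = 0] (mod int p)" "\<not> [- 3 = 0] (mod int p)"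
    using gt3 by (auto simp: cong_0_iff dest: zdvd_imp_le)
  have L3: "Legendre 3 (int p) = 1 \<or> Legendre 3 (int p) = - 1"
    and Lm3: "Legendre (- 3) (int p) = 1 \<or> Legendre (- 3) (int p) = - 1"
    using n0 by (auto simp: Legendre_def)
  have "[Legendre (- 3) (int p) = (- 3) ^ h] (mod int p)"
    unfolding h_def using prime_p gt3 by (intro euler_criterion) auto
  also have "(- 3 :: int) ^ h = (- 1) ^ h * 3 ^ h" by (simp flip: power_mult_distrib)
  also have "[\<dots> = (- 1) ^ h * Legendre 3 (int p)] (mod int p)"
    unfolding h_def using prime_p gt3 by (intro cong_mult cong_refl cong_sym[OF euler_criterion]) auto
  finally have "int p dvd Legendre (- 3) (int p) - (- 1) ^ h * Legendre 3 (int p)"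
    by (simp add: cong_iff_dvd_diff)
  moreover have "\<bar>Legendre (- 3) (int p) - (- 1) ^ h * Legendre 3 (int p)\<bar> < int p"
    using L3 Lm3 gt3 by (cases "even h") auto
  ultimately have "Legendre (- 3) (int p) = (- 1) ^ h * Legendre 3 (int p)"
    using zdvd_not_zless by (metis abs_of_nat dvd_imp_le_int eq_iff_diff_eq_0 not_less)
  moreover have "Legendre (int p) (int 3) * Legendre (int 3) (int p) = (- 1) ^ h"
    using Quadratic_Reciprocity[of p 3] prime_p gt3 by (simp add: h_def)
  ultimately have "Legendre (- 3) (int p) = Legendre (int p) 3"
    using L3 by auto
  also have "\<dots> = (if p mod 3 = 1 then 1 else - 1)"
  proof (cases "p mod 3 = 1")
    case True
    then have "int p mod 3 = 1" by presburger
    then have "[1\<^sup>2 = int p] (mod 3)" by (simp add: cong_def)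
    then have "QuadRes 3 (int p)" unfolding QuadRes_def by blast
    moreover have "\<not> [int p = 0] (mod 3)" using True unfolding cong_def by presburger
    ultimately show ?thesis using True by (simp add: Legendre_def)
  next
    case False
    then have p2: "p mod 3 = 2" using p_mod_3 by simp
    then have p2': "int p mod 3 = 2" by presburger
    have "\<not> QuadRes 3 (int p)"
    proof
      assume "QuadRes 3 (int p)"
      then obtain y where "[y\<^sup>2 = int p] (mod 3)" unfolding QuadRes_def by blast
      then have y: "(y mod 3) * (y mod 3) mod 3 = 2"
        using p2' by (simp add: cong_def power2_eq_square mod_mult_eq)
      have "y mod 3 = 0 \<or> y mod 3 = 1 \<or> y mod 3 = 2" by presburger
      then show False using y by auto
    qed
    moreover have "\<not> [int p = 0] (mod 3)" using p2' unfolding cong_def by presburger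
    ultimately show ?thesis using False by (simp add: Legendre_def)
  qed
  finally show ?thesis .
qed

lemma hsum_2_third:
  "rat_cong p 1 (hsum 2 (p div 3)) (3 * of_int (Legendre (- 3) (int p)) * of_int (U (p - 3)))"
proof -
  define m c where "m = p div 3" and "c = rat_of_int (Legendre (- 3) (int p))"
  define A where "A = (\<Sum>i = 1..m. (- 1) ^ i / rat_of_nat i ^ 2)"
  have half: "p_integral p (1 / 2)" and third: "p_integral p (1 / 3)"
    using p_integral_divide_of_nat[OF not_dvd_less[of 2], of 1]
      p_integral_divide_of_nat[OF not_dvd_less[of 3], of 1] gt3 by auto
  have "rat_cong p 1 (of_int (U (p - 3)) / 2) (c * (1 / 9 * A))"
    using p_mod_3 U_alternating_1 U_alternating_2
    by (auto simp: c_def Legendre_minus_3 A_def m_def)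
  moreover have "c * c = 1" by (simp add: c_def Legendre_minus_3)
  moreover have "p_integral p c" by (simp add: c_def)
  \<comment> \<open>The factor \<open>6 * c\<close> produces \<open>3 * c * U (p - 3)\<close> on the
    left. With \<open>c * c = 1\<close> the right becomes \<open>2 / 3 * A\<close>, congruent to the
    sum of inverse squares.\<close>
  ultimately have 1: "rat_cong p 1 (6 * c * (of_int (U (p - 3)) / 2)) (6 * c * (c * (1 / 9 * A)))"
    by (intro rat_cong_scale p_integral_mult) auto
  have "3 * c * of_int (U (p - 3)) = 6 * c * (of_int (U (p - 3)) / 2)" by simp
  also note 1
  also have "6 * c * (c * (1 / 9 * A)) = 2 * (1 / 3) * A"
    using \<open>c * c = 1\<close> by (simp add: mult.assoc[symmetric])
  also have "rat_cong p 1 (2 * (1 / 3) * A) (2 * (1 / 3) * (3 / 2 * hsum 2 m))"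
    unfolding A_def m_def
    by (intro rat_cong_scale p_integral_mult third alternating_square_sum_third) auto
  also have "2 * (1 / 3) * (3 / 2 * hsum 2 m) = hsum 2 m" by simp
  finally show ?thesis unfolding c_def m_def by (rule rat_cong_sym)
qed

section \<open>Evaluation at the upper argument \<open>- 1 / 3\<close>\<close>

lemma altsum_third:
  defines "m \<equiv> p div 3" and "c \<equiv> rat_of_int (Legendre (- 3) (int p))"
  shows "rat_cong p 2 (altsum (p - 1) (- 1 / 3)) (- hsum 1 m + of_nat p * ((- 1 - 3 * c) / 6 * hsum 2 m))"
proof (cases "p mod 3 = 1")
  case True
  then have c: "c = 1" by (simp add: c_def Legendre_minus_3)
  have p: "p = 3 * m + 1" using True m_def by presburger
  have t: "p_integral p (- 1 / 3)"
    using p_integral_minus[OF p_integral_divide_of_nat[OF not_dvd_less[of 3], of 1]] gt3 by simp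
  \<comment> \<open>Here \<open>t = - 1 / 3\<close> and \<open>r = m\<close>, so the coefficient
    \<open>(- 1 - 3 * c) / 6\<close> is \<open>2 * t\<close>.\<close>
  have "rat_of_nat p * (- 1 / 3) + of_nat m = - 1 / 3" by (subst p) (simp add: field_simps)
  then show ?thesis
    using altsum_p_mult_shift[OF t, of m] c p_pos by (simp add: m_def mult_ac)
next
  case False
  then have c: "c = - 1" by (simp add: c_def Legendre_minus_3)
  have p: "p = 3 * m + 2" using False p_mod_3 m_def by presburger
  have third: "p_integral p (1 / 3)"
    using p_integral_divide_of_nat[OF not_dvd_less[of 3], of 1] gt3 by simp
  then have t: "p_integral p (- 2 / 3)"
    using p_integral_minus[OF p_integral_mult[OF p_integral_numeral third]] by fastforce
  have m: "m < p" using p by simp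
  define r where "r = p - 1 - m"
  \<comment> \<open>Here \<open>t = - 2 / 3\<close> and \<open>r = 2 * m + 1\<close>. Reflection
    returns the sums to \<open>m\<close>, and the coefficient becomes
    \<open>- 1 + 4 / 3 = 1 / 3\<close>.\<close>
  have e: "rat_of_nat p * (- 2 / 3) + of_nat r = - 1 / 3"
    using p by (simp add: r_def field_simps)
  have "r < p" using p_pos by (simp add: r_def)
  then have "rat_cong p 2 (altsum (p - 1) (- 1 / 3)) (- hsum 1 r + 2 * of_nat p * (- 2 / 3) * hsum 2 r)"
    using altsum_p_mult_shift[OF t, of r] unfolding e by blast
  also have "- hsum 1 r + 2 * of_nat p * (- 2 / 3) * hsum 2 r = - hsum 1 r + 2 * (- 2 / 3) * (of_nat p * hsum 2 r)"
    by simp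
  also have "rat_cong p 2 \<dots> (- (hsum 1 m + of_nat p * hsum 2 m) + 2 * (- 2 / 3) * (of_nat p * - hsum 2 m))"
  proof (rule rat_cong_add[OF rat_cong_minus rat_cong_scale])
    show "rat_cong p 2 (hsum 1 r) (hsum 1 m + of_nat p * hsum 2 m)"
      unfolding r_def by (rule hsum_1_reflect[OF m])
    show "rat_cong p 2 (of_nat p * hsum 2 r) (of_nat p * - hsum 2 m)"
      using rat_cong_p_mult[OF hsum_2_reflect[OF m]] by (simp add: r_def numeral_2_eq_2)
    show "p_integral p (2 * (- 2 / 3))" by (intro p_integral_mult t p_integral_numeral)
  qed
  also have "- (hsum 1 m + of_nat p * hsum 2 m) + 2 * (- 2 / 3) * (of_nat p * - hsum 2 m) =
      - hsum 1 m + of_nat p * ((- 1 - 3 * c) / 6 * hsum 2 m) "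
    using c by (simp add: field_simps)
  finally show ?thesis .
qed

lemma altsum_third_U:
  defines "q \<equiv> fermat_quotient p 3"
  shows "rat_cong p 2 (altsum (p - 1) (- 1 / 3))
    (3 / 2 * q - 3 / 4 * of_nat p * q\<^sup>2 -
      (3 - of_int (Legendre (- 3) (int p))) / 2 * of_nat p * of_int (U (p - 3)))"
proof -
  define m c where "m = p div 3" and "c = rat_of_int (Legendre (- 3) (int p))"
  define P where "P = rat_of_nat p"
  have cc: "c = 1 \<or> c = - 1" by (simp add: c_def Legendre_minus_3)
  have half: "p_integral p (1 / 2)" and third: "p_integral p (1 / 3)"
    using p_integral_divide_of_nat[OF not_dvd_less[of 2], of 1]
      p_integral_divide_of_nat[OF not_dvd_less[of 3], of 1] gt3 by auto
  have h2: "rat_cong p 2 (P * hsum 2 m) (P * (3 * c * of_int (U (p - 3))))"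
    using rat_cong_p_mult[OF hsum_2_third] by (simp add: P_def m_def c_def numeral_2_eq_2)
  have Ph: "p_integral p (P * hsum 2 m)" using rat_cong_integral(1)[OF h2] .
  \<comment> \<open>\<open>e = d + 1 / 3\<close> absorbs the term \<open>P / 3 * hsum 2 m\<close> of
    \<open>hsum_third\<close>. By \<open>c ^ 2 = 1\<close>, \<open>e * 3 * c\<close> equals
    \<open>- (3 - c) / 2\<close>.\<close>
  define d e where "d = (- 1 - 3 * c) * (1 / 2) * (1 / 3)" and "e = (1 - 3 * c) * (1 / 2) * (1 / 3)"
  have de: "p_integral p d" "p_integral p e"
    unfolding c_def d_def e_def
    by (intro p_integral_mult p_integral_diff p_integral_minus half third p_integral_of_int
      p_integral_numeral p_integral_1)+
  have "\<not> p dvd 3" using not_dvd_less[of 3] gt3 by simp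
  then have "p_integral p q" unfolding q_def
    using fermat_quotient_of_int by (metis p_integral_of_int)
  then have Q: "p_integral p (3 * (1 / 2) * q - 3 * (1 / 2) * (1 / 2) * P * q ^ 2)"
    unfolding P_def
    by (intro p_integral_mult p_integral_diff p_integral_power half p_integral_of_nat p_integral_numeral)
  have "rat_cong p 2 (altsum (p - 1) (- 1 / 3)) (- hsum 1 m + d * (P * hsum 2 m))"
    using altsum_third by (simp add: m_def c_def P_def d_def mult_ac)
  also have "rat_cong p 2 \<dots>
      (- (- 3 / 2 * q + 3 / 4 * P * q ^ 2 - P / 3 * hsum 2 m) + d * (P * hsum 2 m))"
    using hsum_third Ph de unfolding m_def q_def P_def
    by (intro rat_cong_add rat_cong_minus rat_cong_refl p_integral_mult[of d])
  also have "- (- 3 / 2 * q + 3 / 4 * P * q ^ 2 - P / 3 * hsum 2 m) + d * (P * hsum 2 m) =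
      (3 * (1 / 2) * q - 3 * (1 / 2) * (1 / 2) * P * q ^ 2) + e * (P * hsum 2 m)"
    by (simp add: field_simps d_def e_def)
  also have "rat_cong p 2 \<dots>
      ((3 * (1 / 2) * q - 3 * (1 / 2) * (1 / 2) * P * q ^ 2) + e * (P * (3 * c * of_int (U (p - 3)))))"
    by (intro rat_cong_add rat_cong_refl Q rat_cong_scale de h2)
  also have "\<dots> = 3 / 2 * q - 3 / 4 * P * q\<^sup>2 - (3 - c) / 2 * P * of_int (U (p - 3))"
    using cc by (auto simp: e_def)
  finally show ?thesis by (simp add: c_def P_def)
qed

end

theorem theorem6p3:
  fixes p :: nat
  assumes "prime p" and "p > 3"
  shows "rat_cong p 2
    (\<Sum>k = 1..p - 1. (- 1) ^ k / of_nat k * ((- 1 / 3 :: rat) gchoose k))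
    (3 / 2 * fermat_quotient p 3 - 3 / 4 * of_nat p * (fermat_quotient p 3)\<^sup>2
      - (3 - of_int (Legendre (- 3) (int p))) / 2 * of_nat p * of_int (U (p - 3)))"
proof -
  interpret prime_gt3 p
    using assms by unfold_locales
  show ?thesis using altsum_third_U unfolding altsum_def .
qed

end
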